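(* Let $F : \mathscr{C} \to \mathscr{D}$ be a right-exact (hence additive) covariant functor between abelian categories, where $\mathscr{C}$ has enough injectives. Then the injective stabilization $\overline{F}$ of $F$ is right-exact if and only if all cosyzygy objects in $\mathscr{C}$ have property A with respect to $F$.
   Context: Injective stabilization: for an object $B$ of $\mathscr{C}$ choose an exact sequence $0 \to B \overset{\iota}{\to} I^0 \overset{\partial}{\to} I^1$ with $I^0, I^1$ injective. Then $R^0F(B) = \ker F(\partial)$, the map $F(\iota)$ induces a natural transformation $\rho_F : F \to R^0F$, and $\overline{F} := \ker \rho_F$. A cosyzygy object is a homomorphic image (quotient) of an injective object. An object $C \in \mathscr{C}$ has property A with respect to $F$ if $F(i)$ is a monomorphism whenever $i$ is a monomorphism with domain $C$. *)

theory Defs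
  imports "HOL-Algebra.Group"
begin

section \<open>Categories\<close>

text \<open>
  Objects and arrows are carriers inside two types. \<^term>\<open>Dom\<close>, \<^term>\<open>Cod\<close>, identities and
  composition are unconstrained outside these carriers; composition is written in the usual
  order (\<open>g \<bullet> f\<close> is \<open>f\<close> followed by \<open>g\<close>).
\<close>

record ('o, 'm) cat =
  Ob :: "'o set"
  Ar :: "'m set"
  Dom :: "'m \<Rightarrow> 'o"
  Cod :: "'m \<Rightarrow> 'o"
  Idt :: "'o \<Rightarrow> 'm"
  Comp :: "'m \<Rightarrow> 'm \<Rightarrow> 'm" (infixl \<open>\<bullet>\<index>\<close> 70)

definition Hom :: "('o, 'm, 'c) cat_scheme \<Rightarrow> 'o \<Rightarrow> 'o \<Rightarrow> 'm set" where
  "Hom C A B = {f \<in> Ar C. Dom C f = A \<and> Cod C f = B}"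

locale category =
  fixes C :: "('o, 'm, 'c) cat_scheme" (structure)
  assumes Dom_closed: "f \<in> Ar C \<Longrightarrow> Dom C f \<in> Ob C"
    and Cod_closed: "f \<in> Ar C \<Longrightarrow> Cod C f \<in> Ob C"
    and Idt_closed: "A \<in> Ob C \<Longrightarrow> Idt C A \<in> Hom C A A"
    and Comp_closed: "\<lbrakk>f \<in> Hom C X Y; g \<in> Hom C Y Z\<rbrakk> \<Longrightarrow> g \<bullet> f \<in> Hom C X Z"
    and Comp_Idt_right: "f \<in> Hom C X Y \<Longrightarrow> f \<bullet> Idt C X = f"
    and Comp_Idt_left: "f \<in> Hom C X Y \<Longrightarrow> Idt C Y \<bullet> f = f"
    and Comp_assoc: "\<lbrakk>f \<in> Hom C W X; g \<in> Hom C X Y; h \<in> Hom C Y Z\<rbrakk>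
      \<Longrightarrow> (h \<bullet> g) \<bullet> f = h \<bullet> (g \<bullet> f)"

definition monic :: "('o, 'm, 'c) cat_scheme \<Rightarrow> 'm \<Rightarrow> bool" where
  "monic C m \<longleftrightarrow> m \<in> Ar C \<and>
    (\<forall>X. \<forall>g \<in> Hom C X (Dom C m). \<forall>h \<in> Hom C X (Dom C m).
      m \<bullet>\<^bsub>C\<^esub> g = m \<bullet>\<^bsub>C\<^esub> h \<longrightarrow> g = h)"

definition epic :: "('o, 'm, 'c) cat_scheme \<Rightarrow> 'm \<Rightarrow> bool" where
  "epic C e \<longleftrightarrow> e \<in> Ar C \<and>
    (\<forall>X. \<forall>g \<in> Hom C (Cod C e) X. \<forall>h \<in> Hom C (Cod C e) X.
      g \<bullet>\<^bsub>C\<^esub> e = h \<bullet>\<^bsub>C\<^esub> e \<longrightarrow> g = h)"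

definition is_zero_object :: "('o, 'm, 'c) cat_scheme \<Rightarrow> 'o \<Rightarrow> bool" where
  "is_zero_object C Z \<longleftrightarrow> Z \<in> Ob C \<and>
    (\<forall>A \<in> Ob C. (\<exists>!f. f \<in> Hom C A Z) \<and> (\<exists>!f. f \<in> Hom C Z A))"

definition is_injective :: "('o, 'm, 'c) cat_scheme \<Rightarrow> 'o \<Rightarrow> bool" where
  "is_injective C I \<longleftrightarrow> I \<in> Ob C \<and>
    (\<forall>m. monic C m \<longrightarrow> (\<forall>f \<in> Hom C (Dom C m) I. \<exists>h \<in> Hom C (Cod C m) I. h \<bullet>\<^bsub>C\<^esub> m = f))"

definition enough_injectives :: "('o, 'm, 'c) cat_scheme \<Rightarrow> bool" where
  "enough_injectives C \<longleftrightarrow>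
    (\<forall>A \<in> Ob C. \<exists>m. monic C m \<and> Dom C m = A \<and> is_injective C (Cod C m))"

definition cosyzygy_object :: "('o, 'm, 'c) cat_scheme \<Rightarrow> 'o \<Rightarrow> bool" where
  "cosyzygy_object C X \<longleftrightarrow> (\<exists>I e. is_injective C I \<and> e \<in> Hom C I X \<and> epic C e)"


section \<open>Abelian categories\<close>

text \<open>
  As for composition, \<open>Add\<close> is only meaningful for arrows in a common hom-set;
  \<open>Zero A B\<close> is the neutral element of \<open>Hom A B\<close>.
\<close>

record ('o, 'm) acat = "('o, 'm) cat" +
  Add :: "'m \<Rightarrow> 'm \<Rightarrow> 'm" (infixl \<open>\<boxplus>\<index>\<close> 65)
  Zero :: "'o \<Rightarrow> 'o \<Rightarrow> 'm"

definition Hom_group :: "('o, 'm, 'c) acat_scheme \<Rightarrow> 'o \<Rightarrow> 'o \<Rightarrow> 'm monoid" where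
  "Hom_group C A B = \<lparr>carrier = Hom C A B, monoid.mult = Add C, one = Zero C A B\<rparr>"

locale preadditive_category = category C
  for C :: "('o, 'm, 'c) acat_scheme" (structure) +
  assumes Hom_comm_group: "\<lbrakk>A \<in> Ob C; B \<in> Ob C\<rbrakk> \<Longrightarrow> comm_group (Hom_group C A B)"
    and Comp_Add_right: "\<lbrakk>f \<in> Hom C X Y; g \<in> Hom C X Y; h \<in> Hom C Y Z\<rbrakk>
      \<Longrightarrow> h \<bullet> (f \<boxplus> g) = (h \<bullet> f) \<boxplus> (h \<bullet> g)"
    and Comp_Add_left: "\<lbrakk>f \<in> Hom C X Y; g \<in> Hom C Y Z; h \<in> Hom C Y Z\<rbrakk>
      \<Longrightarrow> (g \<boxplus> h) \<bullet> f = (g \<bullet> f) \<boxplus> (h \<bullet> f)"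

definition is_biproduct ::
  "('o, 'm, 'c) acat_scheme \<Rightarrow> 'o \<Rightarrow> 'o \<Rightarrow> 'o \<Rightarrow> 'm \<Rightarrow> 'm \<Rightarrow> 'm \<Rightarrow> 'm \<Rightarrow> bool" where
  "is_biproduct C A B P i\<^sub>A i\<^sub>B p\<^sub>A p\<^sub>B \<longleftrightarrow>
    i\<^sub>A \<in> Hom C A P \<and> i\<^sub>B \<in> Hom C B P \<and> p\<^sub>A \<in> Hom C P A \<and> p\<^sub>B \<in> Hom C P B \<and>
    p\<^sub>A \<bullet>\<^bsub>C\<^esub> i\<^sub>A = Idt C A \<and> p\<^sub>B \<bullet>\<^bsub>C\<^esub> i\<^sub>B = Idt C B \<and>
    p\<^sub>A \<bullet>\<^bsub>C\<^esub> i\<^sub>B = Zero C B A \<and> p\<^sub>B \<bullet>\<^bsub>C\<^esub> i\<^sub>A = Zero C A B \<and>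
    (i\<^sub>A \<bullet>\<^bsub>C\<^esub> p\<^sub>A) \<boxplus>\<^bsub>C\<^esub> (i\<^sub>B \<bullet>\<^bsub>C\<^esub> p\<^sub>B) = Idt C P"

definition is_kernel :: "('o, 'm, 'c) acat_scheme \<Rightarrow> 'm \<Rightarrow> 'm \<Rightarrow> bool" where
  "is_kernel C f k \<longleftrightarrow> f \<in> Ar C \<and> k \<in> Hom C (Dom C k) (Dom C f) \<and>
    f \<bullet>\<^bsub>C\<^esub> k = Zero C (Dom C k) (Cod C f) \<and>
    (\<forall>X. \<forall>g \<in> Hom C X (Dom C f). f \<bullet>\<^bsub>C\<^esub> g = Zero C X (Cod C f) \<longrightarrow>
      (\<exists>!h. h \<in> Hom C X (Dom C k) \<and> k \<bullet>\<^bsub>C\<^esub> h = g))"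

definition is_cokernel :: "('o, 'm, 'c) acat_scheme \<Rightarrow> 'm \<Rightarrow> 'm \<Rightarrow> bool" where
  "is_cokernel C f c \<longleftrightarrow> f \<in> Ar C \<and> c \<in> Hom C (Cod C f) (Cod C c) \<and>
    c \<bullet>\<^bsub>C\<^esub> f = Zero C (Dom C f) (Cod C c) \<and>
    (\<forall>X. \<forall>g \<in> Hom C (Cod C f) X. g \<bullet>\<^bsub>C\<^esub> f = Zero C (Dom C f) X \<longrightarrow>
      (\<exists>!h. h \<in> Hom C (Cod C c) X \<and> h \<bullet>\<^bsub>C\<^esub> c = g))"

locale abelian_category = preadditive_category C
  for C :: "('o, 'm, 'c) acat_scheme" (structure) +
  assumes zero_object_exists: "\<exists>Z. is_zero_object C Z"
    and biproduct_exists: "\<lbrakk>A \<in> Ob C; B \<in> Ob C\<rbrakk>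
      \<Longrightarrow> \<exists>P i\<^sub>A i\<^sub>B p\<^sub>A p\<^sub>B. is_biproduct C A B P i\<^sub>A i\<^sub>B p\<^sub>A p\<^sub>B"
    and kernel_exists: "f \<in> Ar C \<Longrightarrow> \<exists>k. is_kernel C f k"
    and cokernel_exists: "f \<in> Ar C \<Longrightarrow> \<exists>c. is_cokernel C f c"
    and monic_normal: "monic C m \<Longrightarrow> \<exists>f. is_kernel C f m"
    and epic_normal: "epic C e \<Longrightarrow> \<exists>f. is_cokernel C f e"

definition is_image :: "('o, 'm, 'c) acat_scheme \<Rightarrow> 'm \<Rightarrow> 'm \<Rightarrow> bool" where
  "is_image C f m \<longleftrightarrow> (\<exists>c. is_cokernel C f c \<and> is_kernel C c m)"

text \<open>
  Images and kernels are only determined up to isomorphism, so the equality of the subobjects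
  \<open>im f\<close> and \<open>ker g\<close> says that one arrow represents both.
\<close>

definition exact_at :: "('o, 'm, 'c) acat_scheme \<Rightarrow> 'm \<Rightarrow> 'm \<Rightarrow> bool" where
  "exact_at C f g \<longleftrightarrow> f \<in> Ar C \<and> g \<in> Ar C \<and> Cod C f = Dom C g \<and>
    (\<exists>m. is_image C f m \<and> is_kernel C g m)"

text \<open>Exactness of \<open>\<cdot> \<rightarrow> \<cdot> \<rightarrow> \<cdot> \<rightarrow> 0\<close>, with arrows \<open>f\<close>, \<open>g\<close>, and of \<open>0 \<rightarrow> \<cdot> \<rightarrow> \<cdot> \<rightarrow> \<cdot>\<close>.\<close>

definition right_exact_seq :: "('o, 'm, 'c) acat_scheme \<Rightarrow> 'm \<Rightarrow> 'm \<Rightarrow> bool" where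
  "right_exact_seq C f g \<longleftrightarrow> exact_at C f g \<and>
    (\<exists>Z. is_zero_object C Z \<and> exact_at C g (Zero C (Cod C g) Z))"

definition left_exact_seq :: "('o, 'm, 'c) acat_scheme \<Rightarrow> 'm \<Rightarrow> 'm \<Rightarrow> bool" where
  "left_exact_seq C f g \<longleftrightarrow>
    (\<exists>Z. is_zero_object C Z \<and> exact_at C (Zero C Z (Dom C f)) f) \<and> exact_at C f g"


section \<open>Functors\<close>

record ('o, 'm, 'p, 'n) fctr =
  obj_map :: "'o \<Rightarrow> 'p"
  arr_map :: "'m \<Rightarrow> 'n"

definition covariant_functor ::
  "('o, 'm, 'c) cat_scheme \<Rightarrow> ('p, 'n, 'd) cat_scheme \<Rightarrow> ('o, 'm, 'p, 'n) fctr \<Rightarrow> bool" where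
  "covariant_functor C D F \<longleftrightarrow>
    (\<forall>A \<in> Ob C. obj_map F A \<in> Ob D) \<and>
    (\<forall>A B. \<forall>f \<in> Hom C A B. arr_map F f \<in> Hom D (obj_map F A) (obj_map F B)) \<and>
    (\<forall>A \<in> Ob C. arr_map F (Idt C A) = Idt D (obj_map F A)) \<and>
    (\<forall>X Y Z. \<forall>f \<in> Hom C X Y. \<forall>g \<in> Hom C Y Z.
      arr_map F (g \<bullet>\<^bsub>C\<^esub> f) = arr_map F g \<bullet>\<^bsub>D\<^esub> arr_map F f)"

text \<open>Additivity is not required: it follows from exactness on split sequences.\<close>

definition right_exact ::
  "('o, 'm, 'c) acat_scheme \<Rightarrow> ('p, 'n, 'd) acat_scheme \<Rightarrow> ('o, 'm, 'p, 'n) fctr \<Rightarrow> bool" where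
  "right_exact C D F \<longleftrightarrow> covariant_functor C D F \<and>
    (\<forall>f g. right_exact_seq C f g \<longrightarrow> right_exact_seq D (arr_map F f) (arr_map F g))"

definition property_A ::
  "('o, 'm, 'c) cat_scheme \<Rightarrow> ('p, 'n, 'd) cat_scheme \<Rightarrow> ('o, 'm, 'p, 'n) fctr \<Rightarrow> 'o \<Rightarrow> bool"
  where
  "property_A C D F X \<longleftrightarrow> X \<in> Ob C \<and>
    (\<forall>i. monic C i \<and> Dom C i = X \<longrightarrow> monic D (arr_map F i))"


section \<open>The injective stabilization\<close>

text \<open>
  An injective copresentation \<open>0 \<rightarrow> B \<rightarrow> I\<^sup>0 \<rightarrow> I\<^sup>1\<close> is recorded by its two arrows. A choice of
  such a sequence for every object is a pair of functions \<open>\<iota>\<close>, \<open>\<delta>\<close> from objects to arrows.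
\<close>

definition injective_copresentation ::
  "('o, 'm, 'c) acat_scheme \<Rightarrow> 'o \<Rightarrow> 'm \<Rightarrow> 'm \<Rightarrow> bool" where
  "injective_copresentation C B i d \<longleftrightarrow> Dom C i = B \<and> left_exact_seq C i d \<and>
    is_injective C (Cod C i) \<and> is_injective C (Cod C d)"

definition ker :: "('o, 'm, 'c) acat_scheme \<Rightarrow> 'm \<Rightarrow> 'm" where
  "ker C f = (SOME k. is_kernel C f k)"

text \<open>
  \<open>R\<^sup>0F\<close> sends \<open>f : A \<rightarrow> B\<close> to the arrow \<open>ker F(\<delta> A) \<rightarrow> ker F(\<delta> B)\<close> induced by any lift
  \<open>(\<phi>, \<psi>)\<close> of \<open>f\<close> to the chosen copresentations.
\<close>

definition R0 ::
  "('o, 'm, 'c) acat_scheme \<Rightarrow> ('p, 'n, 'd) acat_scheme \<Rightarrow> ('o \<Rightarrow> 'm) \<Rightarrow> ('o \<Rightarrow> 'm)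
    \<Rightarrow> ('o, 'm, 'p, 'n) fctr \<Rightarrow> ('o, 'm, 'p, 'n) fctr" where
  "R0 C D \<iota> \<delta> F =
    (let k = (\<lambda>B. ker D (arr_map F (\<delta> B))) in
    \<lparr>obj_map = (\<lambda>B. Dom D (k B)),
     arr_map = (\<lambda>f. let A = Dom C f; B = Cod C f in
       THE g. g \<in> Hom D (Dom D (k A)) (Dom D (k B)) \<and>
         (\<exists>\<phi> \<psi>. \<phi> \<in> Hom C (Cod C (\<iota> A)) (Cod C (\<iota> B)) \<and>
                \<psi> \<in> Hom C (Cod C (\<delta> A)) (Cod C (\<delta> B)) \<and>
                \<phi> \<bullet>\<^bsub>C\<^esub> \<iota> A = \<iota> B \<bullet>\<^bsub>C\<^esub> f \<and> \<psi> \<bullet>\<^bsub>C\<^esub> \<delta> A = \<delta> B \<bullet>\<^bsub>C\<^esub> \<phi> \<and>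
                k B \<bullet>\<^bsub>D\<^esub> g = arr_map F \<phi> \<bullet>\<^bsub>D\<^esub> k A))\<rparr>)"

definition rho ::
  "('o, 'm, 'c) acat_scheme \<Rightarrow> ('p, 'n, 'd) acat_scheme \<Rightarrow> ('o \<Rightarrow> 'm) \<Rightarrow> ('o \<Rightarrow> 'm)
    \<Rightarrow> ('o, 'm, 'p, 'n) fctr \<Rightarrow> 'o \<Rightarrow> 'n" where
  "rho C D \<iota> \<delta> F B =
    (THE r. r \<in> Hom D (obj_map F B) (obj_map (R0 C D \<iota> \<delta> F) B) \<and>
            ker D (arr_map F (\<delta> B)) \<bullet>\<^bsub>D\<^esub> r = arr_map F (\<iota> B))"

text \<open>
  The kernel of a natural transformation \<open>\<tau>\<close> with source \<open>F\<close>: kernels are formed componentwise,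
  and the action on arrows is the restriction of that of \<open>F\<close>.
\<close>

definition nat_ker ::
  "('o, 'm, 'c) acat_scheme \<Rightarrow> ('p, 'n, 'd) acat_scheme
    \<Rightarrow> ('o, 'm, 'p, 'n) fctr \<Rightarrow> ('o \<Rightarrow> 'n) \<Rightarrow> ('o, 'm, 'p, 'n) fctr" where
  "nat_ker C D F \<tau> =
    \<lparr>obj_map = (\<lambda>B. Dom D (ker D (\<tau> B))),
     arr_map = (\<lambda>f. let A = Dom C f; B = Cod C f in
       THE g. g \<in> Hom D (Dom D (ker D (\<tau> A))) (Dom D (ker D (\<tau> B))) \<and>
         ker D (\<tau> B) \<bullet>\<^bsub>D\<^esub> g = arr_map F f \<bullet>\<^bsub>D\<^esub> ker D (\<tau> A))\<rparr>"

definition injective_stabilization ::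
  "('o, 'm, 'c) acat_scheme \<Rightarrow> ('p, 'n, 'd) acat_scheme \<Rightarrow> ('o \<Rightarrow> 'm) \<Rightarrow> ('o \<Rightarrow> 'm)
    \<Rightarrow> ('o, 'm, 'p, 'n) fctr \<Rightarrow> ('o, 'm, 'p, 'n) fctr" where
  "injective_stabilization C D \<iota> \<delta> F = nat_ker C D F (rho C D \<iota> \<delta> F)"

end

theory Submission
  imports Defs
begin

text \<open>
  Write \<open>S\<close> for the injective stabilization of \<open>F\<close>. Since \<open>\<rho>\<close> followed by the inclusion of
  \<open>R\<^sup>0F(B)\<close> is \<open>F(\<iota>\<^sub>B)\<close>, the object \<open>S(B)\<close> is the kernel of \<open>F(\<iota>\<^sub>B)\<close>. The arrow \<open>\<iota>\<^sub>B\<close> factors through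
  every monic \<open>m\<close> out of \<open>B\<close>, and every \<open>h\<close> from \<open>B\<close> to an injective object factors through \<open>\<iota>\<^sub>B\<close>.
  Hence an element of \<open>F(B)\<close> killed by \<open>F(m)\<close> for a single monic \<open>m\<close> lies in \<open>S(B)\<close>, and an element
  of \<open>S(B)\<close> is killed by every such \<open>F(h)\<close>. So \<open>S(B)\<close> does not
  depend on the chosen copresentation, it is zero when \<open>B\<close> is injective, and it is zero exactly when
  \<open>B\<close> has property A.

  If \<open>S\<close> is right exact, it preserves epimorphisms. A cosyzygy object \<open>X\<close> is a quotient of an
  injective \<open>J\<close>, and \<open>S(J) = 0\<close>, so \<open>S(X) = 0\<close>: this is property A for \<open>X\<close>
  (\<open>property_A_of_stab_epic\<close>).

  Conversely, right exactness of \<open>S\<close> comes down to preservation of epimorphisms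
  (\<open>stab_exact_of_epic\<close>). For a monic \<open>i : A' \<rightarrow> B\<close> with cokernel \<open>g\<close>, an element of \<open>S(B)\<close> killed by
  \<open>F(g)\<close> comes from some element of \<open>F(A')\<close>, which dies in an injective object containing \<open>B\<close>, and
  therefore lies in \<open>S(A')\<close>; a general \<open>f\<close> is an epimorphism followed by a monic one.

  That epimorphisms are preserved is where the hypothesis enters (\<open>stab_epic_of_property_A\<close>). Let
  \<open>K\<close> be the kernel of \<open>e : B \<rightarrow> B'\<close> and embed \<open>B\<close> in an injective \<open>I\<close>. Then \<open>B' = B/K\<close> maps to the
  cosyzygy object \<open>I/K\<close>. Composed with an embedding of \<open>I/K\<close> in an injective object, this map
  kills \<open>S(B')\<close>, so by property A for \<open>I/K\<close> an element \<open>x\<close> of \<open>S(B')\<close> already dies in \<open>F(I/K)\<close>. Lift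
  \<open>x\<close> to \<open>y\<close> in \<open>F(B)\<close>. The image of \<open>y\<close> in \<open>F(I)\<close> dies in \<open>F(I/K)\<close>, hence comes from some \<open>z\<close> in
  \<open>F(K)\<close>. Subtracting the image of \<open>z\<close> from \<open>y\<close> gives an element of \<open>S(B)\<close> that still lifts \<open>x\<close>.

  The elements here are generalized ones: an element of \<open>A\<close> is an arrow into \<open>A\<close>, and a lift of it
  along an epimorphism exists after precomposition with another epimorphism
  (\<open>pullback_of_epic\<close>). Exactness can be tested on them (\<open>exact_at_iff\<close>).
\<close>

section \<open>Arrows and composition\<close>

lemma Hom_iff: "f \<in> Hom C A B \<longleftrightarrow> f \<in> Ar C \<and> Dom C f = A \<and> Cod C f = B"
  by (simp add: Hom_def)

context category
begin

text \<open>
  Membership in a hom-set has two parameters that a rewriter cannot guess. Stated through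
  domains and codomains instead, the laws of a category become usable as rewrite rules.
\<close>

lemma comp_arrow [simp]:
  assumes "f \<in> Ar C" "g \<in> Ar C" "Cod C f = Dom C g"
  shows "g \<bullet> f \<in> Ar C" "Dom C (g \<bullet> f) = Dom C f" "Cod C (g \<bullet> f) = Cod C g"
  using Comp_closed[of f "Dom C f" "Dom C g" g "Cod C g"] assms by (auto simp: Hom_iff)

lemma comp_assoc [simp]:
  assumes "f \<in> Ar C" "g \<in> Ar C" "h \<in> Ar C" "Cod C f = Dom C g" "Cod C g = Dom C h"
  shows "(h \<bullet> g) \<bullet> f = h \<bullet> (g \<bullet> f)"
  using Comp_assoc[of f "Dom C f" "Dom C g" g "Dom C h" h "Cod C h"] assms
  by (auto simp: Hom_iff)

lemma identity_arrow [simp]: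
  assumes "A \<in> Ob C"
  shows "Idt C A \<in> Ar C" "Dom C (Idt C A) = A" "Cod C (Idt C A) = A"
  using Idt_closed[OF assms] by (auto simp: Hom_iff)

lemma comp_identity [simp]:
  "f \<in> Ar C \<Longrightarrow> A = Dom C f \<Longrightarrow> f \<bullet> Idt C A = f"
  "f \<in> Ar C \<Longrightarrow> A = Cod C f \<Longrightarrow> Idt C A \<bullet> f = f"
  using Comp_Idt_right Comp_Idt_left by (auto simp: Hom_iff)

lemma endpoints [simp]: "f \<in> Ar C \<Longrightarrow> Dom C f \<in> Ob C" "f \<in> Ar C \<Longrightarrow> Cod C f \<in> Ob C"
  using Dom_closed Cod_closed by auto

lemma monic_arrow: "monic C m \<Longrightarrow> m \<in> Ar C"
  by (simp add: monic_def)

lemma epic_arrow: "epic C e \<Longrightarrow> e \<in> Ar C"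
  by (simp add: epic_def)

lemma monic_cancel:
  assumes "monic C m" "g \<in> Ar C" "h \<in> Ar C" "Dom C g = Dom C h"
    "Cod C g = Dom C m" "Cod C h = Dom C m" "m \<bullet> g = m \<bullet> h"
  shows "g = h"
  using assms by (auto simp: monic_def Hom_iff)

lemma epic_cancel:
  assumes "epic C e" "g \<in> Ar C" "h \<in> Ar C" "Cod C g = Cod C h"
    "Dom C g = Cod C e" "Dom C h = Cod C e" "g \<bullet> e = h \<bullet> e"
  shows "g = h"
  using assms by (auto simp: epic_def Hom_iff)

lemma epic_of_comp:
  assumes "f \<in> Ar C" "g \<in> Ar C" "Cod C f = Dom C g" "epic C (g \<bullet> f)"
  shows "epic C g"
  unfolding epic_def
proof (intro conjI allI ballI impI, unfold Hom_iff)
  fix X x y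
  assume x: "x \<in> Ar C \<and> Dom C x = Cod C g \<and> Cod C x = X"
    and y: "y \<in> Ar C \<and> Dom C y = Cod C g \<and> Cod C y = X"
    and eq: "x \<bullet> g = y \<bullet> g"
  have "x \<bullet> (g \<bullet> f) = (x \<bullet> g) \<bullet> f" "y \<bullet> (g \<bullet> f) = (y \<bullet> g) \<bullet> f"
    using x y assms(1-3) by simp_all
  then have "x \<bullet> (g \<bullet> f) = y \<bullet> (g \<bullet> f)"
    using eq by simp
  then show "x = y"
    using epic_cancel[OF assms(4)] x y assms(1-3) by simp
qed (use assms in simp)

lemma monic_comp:
  assumes "monic C f" "monic C g" "Cod C f = Dom C g"
  shows "monic C (g \<bullet> f)"
  unfolding monic_def
proof (intro conjI allI ballI impI, unfold Hom_iff)
  note ar = monic_arrow[OF assms(1)] monic_arrow[OF assms(2)]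
  show "g \<bullet> f \<in> Ar C"
    using ar assms(3) by simp
  fix X x y
  assume "x \<in> Ar C \<and> Dom C x = X \<and> Cod C x = Dom C (g \<bullet> f)"
    and "y \<in> Ar C \<and> Dom C y = X \<and> Cod C y = Dom C (g \<bullet> f)"
    and eq: "(g \<bullet> f) \<bullet> x = (g \<bullet> f) \<bullet> y"
  then have x: "x \<in> Ar C \<and> Dom C x = X \<and> Cod C x = Dom C f"
    and y: "y \<in> Ar C \<and> Dom C y = X \<and> Cod C y = Dom C f"
    using ar assms(3) by simp_all
  have "g \<bullet> (f \<bullet> x) = g \<bullet> (f \<bullet> y)"
    using eq x y ar assms(3) by simp
  then have "f \<bullet> x = f \<bullet> y"
    using monic_cancel[OF assms(2), of "f \<bullet> x" "f \<bullet> y"] x y ar assms(3) by simp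
  then show "x = y"
    using monic_cancel[OF assms(1)] x y by simp
qed

lemma epic_comp:
  assumes "epic C f" "epic C g" "Cod C f = Dom C g"
  shows "epic C (g \<bullet> f)"
  unfolding epic_def
proof (intro conjI allI ballI impI, unfold Hom_iff)
  note ar = epic_arrow[OF assms(1)] epic_arrow[OF assms(2)]
  show "g \<bullet> f \<in> Ar C"
    using ar assms(3) by simp
  fix X x y
  assume "x \<in> Ar C \<and> Dom C x = Cod C (g \<bullet> f) \<and> Cod C x = X"
    and "y \<in> Ar C \<and> Dom C y = Cod C (g \<bullet> f) \<and> Cod C y = X"
    and eq: "x \<bullet> (g \<bullet> f) = y \<bullet> (g \<bullet> f)"
  then have x: "x \<in> Ar C \<and> Dom C x = Cod C g \<and> Cod C x = X"
    and y: "y \<in> Ar C \<and> Dom C y = Cod C g \<and> Cod C y = X"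
    using ar assms(3) by simp_all
  have "(x \<bullet> g) \<bullet> f = (y \<bullet> g) \<bullet> f"
    using eq x y ar assms(3) by simp
  then have "x \<bullet> g = y \<bullet> g"
    using epic_cancel[OF assms(1), of "x \<bullet> g" "y \<bullet> g"] x y ar assms(3) by simp
  then show "x = y"
    using epic_cancel[OF assms(2)] x y by simp
qed

lemma identity_epic: "A \<in> Ob C \<Longrightarrow> epic C (Idt C A)"
  by (auto simp: epic_def Hom_iff)

lemma injective_extend:
  assumes "is_injective C J" "monic C m" "f \<in> Ar C" "Dom C f = Dom C m" "Cod C f = J"
  shows "\<exists>h. h \<in> Ar C \<and> Dom C h = Cod C m \<and> Cod C h = J \<and> h \<bullet> m = f"
  using assms unfolding is_injective_def Hom_iff Bex_def Ball_def by metis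

end


section \<open>Addition of arrows\<close>

context preadditive_category
begin

lemma zero_arrow [simp]:
  assumes "A \<in> Ob C" "B \<in> Ob C"
  shows "Zero C A B \<in> Ar C" "Dom C (Zero C A B) = A" "Cod C (Zero C A B) = B"
proof -
  interpret G: comm_group "Hom_group C A B" using Hom_comm_group assms by blast
  have "Zero C A B \<in> Hom C A B" using G.one_closed by (simp add: Hom_group_def)
  then show "Zero C A B \<in> Ar C" "Dom C (Zero C A B) = A" "Cod C (Zero C A B) = B"
    by (auto simp: Hom_iff)
qed

lemma add_zero_left:
  assumes "f \<in> Ar C" "A = Dom C f" "B = Cod C f"
  shows "Zero C A B \<boxplus> f = f"
proof -
  interpret G: comm_group "Hom_group C A B" using Hom_comm_group assms by simp
  show ?thesis using G.l_one[of f] assms by (simp add: Hom_group_def Hom_iff)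
qed

lemma add_zero_right:
  assumes "f \<in> Ar C" "A = Dom C f" "B = Cod C f"
  shows "f \<boxplus> Zero C A B = f"
proof -
  interpret G: comm_group "Hom_group C A B" using Hom_comm_group assms by simp
  show ?thesis using G.r_one[of f] assms by (simp add: Hom_group_def Hom_iff)
qed

lemma add_eq_right_imp_zero:
  assumes "f \<in> Ar C" "g \<in> Ar C" "Dom C f = Dom C g" "Cod C f = Cod C g" "f \<boxplus> g = g"
    "A = Dom C g" "B = Cod C g"
  shows "f = Zero C A B"
proof -
  interpret G: comm_group "Hom_group C (Dom C g) (Cod C g)" using Hom_comm_group assms by simp
  show ?thesis using G.r_cancel_one[of g f] assms by (simp add: Hom_group_def Hom_iff)
qed

text \<open>
  Subtraction is stated through the equation \<open>d + g = f\<close> because diagram chases compose this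
  equation with further arrows and then cancel.
\<close>

lemma difference_exists:
  assumes "f \<in> Ar C" "g \<in> Ar C" "Dom C f = Dom C g" "Cod C f = Cod C g"
  shows "\<exists>d. d \<in> Ar C \<and> Dom C d = Dom C g \<and> Cod C d = Cod C g \<and> d \<boxplus> g = f"
proof -
  let ?G = "Hom_group C (Dom C g) (Cod C g)"
  interpret G: comm_group ?G using Hom_comm_group assms by simp
  have fg: "f \<in> carrier ?G" "g \<in> carrier ?G"
    using assms by (simp_all add: Hom_group_def Hom_iff)
  define d where "d = monoid.mult ?G f (m_inv ?G g)"
  have "d \<in> carrier ?G" "monoid.mult ?G d g = f"
    using fg by (simp_all add: d_def G.m_assoc)
  then show ?thesis by (auto simp: Hom_group_def Hom_iff)
qed

lemma comp_add_right:
  assumes "f \<in> Ar C" "g \<in> Ar C" "h \<in> Ar C" "Dom C f = Dom C g" "Cod C f = Cod C g"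
    "Cod C g = Dom C h"
  shows "h \<bullet> (f \<boxplus> g) = (h \<bullet> f) \<boxplus> (h \<bullet> g)"
  using Comp_Add_right[of f "Dom C g" "Dom C h" g h "Cod C h"] assms by (simp add: Hom_iff)

lemma comp_add_left:
  assumes "f \<in> Ar C" "g \<in> Ar C" "h \<in> Ar C" "Dom C g = Dom C h" "Cod C g = Cod C h"
    "Cod C f = Dom C h"
  shows "(g \<boxplus> h) \<bullet> f = (g \<bullet> f) \<boxplus> (h \<bullet> f)"
  using Comp_Add_left[of f "Dom C f" "Dom C h" g "Cod C h" h] assms by (simp add: Hom_iff)

lemma comp_zero_right [simp]:
  assumes "h \<in> Ar C" "A \<in> Ob C" "B = Dom C h"
  shows "h \<bullet> Zero C A B = Zero C A (Cod C h)"
proof -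
  let ?z = "Zero C A B"
  have "?z \<boxplus> ?z = ?z" using assms by (intro add_zero_left) simp_all
  then have "(h \<bullet> ?z) \<boxplus> (h \<bullet> ?z) = h \<bullet> ?z"
    using comp_add_right[of ?z ?z h] assms by simp
  then show ?thesis using assms by (intro add_eq_right_imp_zero[of _ "h \<bullet> ?z"]) simp_all
qed

lemma comp_zero_left [simp]:
  assumes "f \<in> Ar C" "B \<in> Ob C" "A = Cod C f"
  shows "Zero C A B \<bullet> f = Zero C (Dom C f) B"
proof -
  let ?z = "Zero C A B"
  have z: "?z \<in> Ar C" "Dom C ?z = Cod C f" "Cod C ?z = B"
    using assms by simp_all
  have "?z \<boxplus> ?z = ?z"
    using z by (intro add_zero_left) (simp_all add: assms(3))
  then have "(?z \<bullet> f) \<boxplus> (?z \<bullet> f) = ?z \<bullet> f"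
    using comp_add_left[of f ?z ?z] assms(1) z by metis
  then show ?thesis
    by (rule add_eq_right_imp_zero[rotated 4]) (use assms(1) z in simp_all)
qed

lemma monic_zeroD:
  assumes "monic C m" "x \<in> Ar C" "Cod C x = Dom C m" "m \<bullet> x = Zero C (Dom C x) (Cod C m)"
    "A = Dom C x" "B = Dom C m"
  shows "x = Zero C A B"
  by (rule monic_cancel[OF assms(1)]) (use assms monic_arrow[OF assms(1)] in simp_all)

lemma epic_zeroD:
  assumes "epic C e" "u \<in> Ar C" "Dom C u = Cod C e" "u \<bullet> e = Zero C (Dom C e) (Cod C u)"
    "A = Cod C e" "B = Cod C u"
  shows "u = Zero C A B"
  by (rule epic_cancel[OF assms(1)]) (use assms epic_arrow[OF assms(1)] in simp_all)

lemma monicI: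
  assumes m: "m \<in> Ar C"
    and zero: "\<And>x. \<lbrakk>x \<in> Ar C; Cod C x = Dom C m; m \<bullet> x = Zero C (Dom C x) (Cod C m)\<rbrakk>
      \<Longrightarrow> x = Zero C (Dom C x) (Dom C m)"
  shows "monic C m"
  unfolding monic_def
proof (intro conjI allI ballI impI, unfold Hom_iff)
  fix X x y
  assume x: "x \<in> Ar C \<and> Dom C x = X \<and> Cod C x = Dom C m"
    and y: "y \<in> Ar C \<and> Dom C y = X \<and> Cod C y = Dom C m"
    and eq: "m \<bullet> x = m \<bullet> y"
  obtain d where d: "d \<in> Ar C" "Dom C d = X" "Cod C d = Dom C m" "d \<boxplus> y = x"
    using difference_exists[of x y] x y by auto
  have "(m \<bullet> d) \<boxplus> (m \<bullet> y) = m \<bullet> y"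
    using comp_add_right[of d y m] d y m eq by metis
  then have "m \<bullet> d = Zero C (Dom C d) (Cod C m)"
    using d y m by (intro add_eq_right_imp_zero[of _ "m \<bullet> y"]) simp_all
  then have "d = Zero C X (Dom C m)"
    using zero[of d] d(1-3) by metis
  then show "x = y"
    using add_zero_left[of y] d y by simp
qed (rule m)

lemma epicI:
  assumes e: "e \<in> Ar C"
    and zero: "\<And>u. \<lbrakk>u \<in> Ar C; Dom C u = Cod C e; u \<bullet> e = Zero C (Dom C e) (Cod C u)\<rbrakk>
      \<Longrightarrow> u = Zero C (Cod C e) (Cod C u)"
  shows "epic C e"
  unfolding epic_def
proof (intro conjI allI ballI impI, unfold Hom_iff)
  fix X x y
  assume x: "x \<in> Ar C \<and> Dom C x = Cod C e \<and> Cod C x = X"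
    and y: "y \<in> Ar C \<and> Dom C y = Cod C e \<and> Cod C y = X"
    and eq: "x \<bullet> e = y \<bullet> e"
  obtain d where d: "d \<in> Ar C" "Dom C d = Cod C e" "Cod C d = X" "d \<boxplus> y = x"
    using difference_exists[of x y] x y by auto
  have "(d \<bullet> e) \<boxplus> (y \<bullet> e) = y \<bullet> e"
    using comp_add_left[of e d y] d y e eq by metis
  then have "d \<bullet> e = Zero C (Dom C e) (Cod C d)"
    using d y e by (intro add_eq_right_imp_zero[of _ "y \<bullet> e"]) simp_all
  then have "d = Zero C (Cod C e) X"
    using zero[of d] d(1-3) by metis
  then show "x = y"
    using add_zero_left[of y] d y by simp
qed (rule e)

lemma kernel_arrow:
  assumes "is_kernel C f k"
  shows "f \<in> Ar C" "k \<in> Ar C" "Cod C k = Dom C f" "f \<bullet> k = Zero C (Dom C k) (Cod C f)"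
  using assms by (auto simp: is_kernel_def Hom_iff)

lemma cokernel_arrow:
  assumes "is_cokernel C f c"
  shows "f \<in> Ar C" "c \<in> Ar C" "Dom C c = Cod C f" "c \<bullet> f = Zero C (Dom C f) (Cod C c)"
  using assms by (auto simp: is_cokernel_def Hom_iff)

lemma kernel_factor:
  assumes "is_kernel C f k" "x \<in> Ar C" "Cod C x = Dom C f" "f \<bullet> x = Zero C (Dom C x) (Cod C f)"
  shows "\<exists>y. y \<in> Ar C \<and> Dom C y = Dom C x \<and> Cod C y = Dom C k \<and> k \<bullet> y = x"
  using assms unfolding is_kernel_def Hom_iff Ball_def Ex1_def by metis

lemma cokernel_factor:
  assumes "is_cokernel C f c" "u \<in> Ar C" "Dom C u = Cod C f" "u \<bullet> f = Zero C (Dom C f) (Cod C u)"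
  shows "\<exists>v. v \<in> Ar C \<and> Dom C v = Cod C c \<and> Cod C v = Cod C u \<and> v \<bullet> c = u"
  using assms unfolding is_cokernel_def Hom_iff Ball_def Ex1_def by metis

lemma kernel_monic:
  assumes k: "is_kernel C f k"
  shows "monic C k"
proof (rule monicI)
  note ar = kernel_arrow[OF k]
  show "k \<in> Ar C" by (rule ar)
  fix x assume x: "x \<in> Ar C" "Cod C x = Dom C k" "k \<bullet> x = Zero C (Dom C x) (Cod C k)"
  let ?z = "Zero C (Dom C x) (Dom C k)"
  have "f \<bullet> (k \<bullet> x) = Zero C (Dom C x) (Cod C f)" using x ar by simp
  moreover have "k \<bullet> x \<in> Hom C (Dom C x) (Dom C f)" using x ar by (simp add: Hom_iff)
  ultimately have "\<exists>!h. h \<in> Hom C (Dom C x) (Dom C k) \<and> k \<bullet> h = k \<bullet> x"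
    using k unfolding is_kernel_def by blast
  moreover have "?z \<in> Hom C (Dom C x) (Dom C k) \<and> k \<bullet> ?z = k \<bullet> x"
    "x \<in> Hom C (Dom C x) (Dom C k) \<and> k \<bullet> x = k \<bullet> x"
    using x ar by (simp_all add: Hom_iff)
  ultimately show "x = ?z" by blast
qed

lemma cokernel_epic:
  assumes c: "is_cokernel C f c"
  shows "epic C c"
proof (rule epicI)
  note ar = cokernel_arrow[OF c]
  show "c \<in> Ar C" by (rule ar)
  fix u assume u: "u \<in> Ar C" "Dom C u = Cod C c" "u \<bullet> c = Zero C (Dom C c) (Cod C u)"
  let ?z = "Zero C (Cod C c) (Cod C u)"
  have "(u \<bullet> c) \<bullet> f = Zero C (Dom C f) (Cod C u)" unfolding u(3) using u ar by simp
  moreover have "u \<bullet> c \<in> Hom C (Cod C f) (Cod C u)" using u ar by (simp add: Hom_iff)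
  ultimately have "\<exists>!h. h \<in> Hom C (Cod C c) (Cod C u) \<and> h \<bullet> c = u \<bullet> c"
    using c unfolding is_cokernel_def by blast
  moreover have "?z \<in> Hom C (Cod C c) (Cod C u) \<and> ?z \<bullet> c = u \<bullet> c"
    "u \<in> Hom C (Cod C c) (Cod C u) \<and> u \<bullet> c = u \<bullet> c"
    using u ar by (simp_all add: Hom_iff)
  ultimately show "u = ?z" by blast
qed

lemma is_kernelI:
  assumes f: "f \<in> Ar C" and k: "monic C k" "Cod C k = Dom C f"
    and zero: "f \<bullet> k = Zero C (Dom C k) (Cod C f)"
    and factor: "\<And>x. \<lbrakk>x \<in> Ar C; Cod C x = Dom C f; f \<bullet> x = Zero C (Dom C x) (Cod C f)\<rbrakk>
      \<Longrightarrow> \<exists>y. y \<in> Ar C \<and> Dom C y = Dom C x \<and> Cod C y = Dom C k \<and> k \<bullet> y = x"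
  shows "is_kernel C f k"
  unfolding is_kernel_def
proof (intro conjI allI ballI impI)
  fix X x assume "x \<in> Hom C X (Dom C f)" "f \<bullet> x = Zero C X (Cod C f)"
  then obtain y where "y \<in> Hom C X (Dom C k)" "k \<bullet> y = x"
    using factor[of x] by (auto simp: Hom_iff)
  then show "\<exists>!h. h \<in> Hom C X (Dom C k) \<and> k \<bullet> h = x"
    using k(1) unfolding monic_def by blast
qed (use f k zero monic_arrow[OF k(1)] in \<open>auto simp: Hom_iff\<close>)

text \<open>
  Postcomposition with a monic arrow does not change which elements are killed. This removes
  \<open>R\<^sup>0F\<close> from the description of the stabilization.
\<close>

lemma kernel_of_monic_comp:
  assumes k: "is_kernel C r k" and j: "monic C j" "Dom C j = Cod C r"
  shows "is_kernel C (j \<bullet> r) k"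
proof (rule is_kernelI)
  note ar = kernel_arrow(1-3)[OF k] monic_arrow[OF j(1)]
  show "j \<bullet> r \<in> Ar C" "monic C k" "Cod C k = Dom C (j \<bullet> r)"
    using ar j(2) kernel_monic[OF k] by simp_all
  show "(j \<bullet> r) \<bullet> k = Zero C (Dom C k) (Cod C (j \<bullet> r))"
    using ar j(2) kernel_arrow(4)[OF k] by simp
  fix x assume x: "x \<in> Ar C" "Cod C x = Dom C (j \<bullet> r)"
    "(j \<bullet> r) \<bullet> x = Zero C (Dom C x) (Cod C (j \<bullet> r))"
  then have x': "Cod C x = Dom C r" "j \<bullet> (r \<bullet> x) = Zero C (Dom C x) (Cod C j)"
    using ar j(2) by simp_all
  have "r \<bullet> x = Zero C (Dom C x) (Cod C r)"
    by (rule monic_zeroD[OF j(1)]) (use x(1) x' ar j(2) in simp_all)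
  then show "\<exists>y. y \<in> Ar C \<and> Dom C y = Dom C x \<and> Cod C y = Dom C k \<and> k \<bullet> y = x"
    using kernel_factor[OF k x(1) x'(1)] by simp
qed

end


section \<open>Exactness tested on generalized elements\<close>

context abelian_category
begin

lemma ker_is_kernel: "f \<in> Ar C \<Longrightarrow> is_kernel C f (ker C f)"
  unfolding ker_def using kernel_exists by (rule someI_ex)

text \<open>
  An epimorphism is the cokernel of its kernel: it is the cokernel of some arrow \<open>w\<close> by
  normality, and whatever kills the kernel kills \<open>w\<close>, which factors through the kernel.
\<close>

lemma epic_factor_through_kernel:
  assumes e: "epic C e" and k: "is_kernel C e k"
    and u: "u \<in> Ar C" "Dom C u = Dom C e" "u \<bullet> k = Zero C (Dom C k) (Cod C u)"
  shows "\<exists>v. v \<in> Ar C \<and> Dom C v = Cod C e \<and> Cod C v = Cod C u \<and> v \<bullet> e = u"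
proof -
  note ark = kernel_arrow[OF k]
  obtain w where w: "is_cokernel C w e" using epic_normal[OF e] by blast
  note arw = cokernel_arrow[OF w]
  obtain t where t: "t \<in> Ar C" "Dom C t = Dom C w" "Cod C t = Dom C k" "k \<bullet> t = w"
    using kernel_factor[OF k, of w] arw by auto
  have "u \<bullet> w = (u \<bullet> k) \<bullet> t" unfolding t(4)[symmetric] using t u(1,2) ark by simp
  also have "\<dots> = Zero C (Dom C w) (Cod C u)" unfolding u(3) using t u ark by simp
  finally show ?thesis using cokernel_factor[OF w, of u] u arw by simp
qed

text \<open>
  The pullback is the kernel of \<open>f p - g q\<close> on the biproduct with projections \<open>p\<close> and \<open>q\<close>. This
  difference restricts to \<open>f\<close> on the first summand, so it is epic and hence the cokernel of its
  kernel. If \<open>u\<close> kills the projection of the kernel to the second summand, then \<open>u q\<close> factors through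
  the difference by some \<open>v\<close>; restricted to the first summand this gives \<open>v f = 0\<close>, so \<open>v = 0\<close> and
  \<open>u = 0\<close>.
\<close>

lemma pullback_of_epic:
  assumes f: "epic C f" and g: "g \<in> Ar C" and fg: "Cod C f = Cod C g"
  shows "\<exists>p y. epic C p \<and> Cod C p = Dom C g \<and>
    y \<in> Ar C \<and> Dom C y = Dom C p \<and> Cod C y = Dom C f \<and> f \<bullet> y = g \<bullet> p"
proof -
  note far = epic_arrow[OF f]
  obtain P i j p q where bi: "is_biproduct C (Dom C f) (Dom C g) P i j p q"
    using biproduct_exists[of "Dom C f" "Dom C g"] far g by auto
  note bp = bi[unfolded is_biproduct_def Hom_iff]
  obtain d where d: "d \<in> Ar C" "Dom C d = P" "Cod C d = Cod C g" "d \<boxplus> (g \<bullet> q) = f \<bullet> p"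
    using difference_exists[of "f \<bullet> p" "g \<bullet> q"] bp far g fg by auto
  have "(d \<bullet> i) \<boxplus> ((g \<bullet> q) \<bullet> i) = (f \<bullet> p) \<bullet> i"
    using comp_add_left[of i d "g \<bullet> q"] d bp g by simp
  moreover have "(g \<bullet> q) \<bullet> i = Zero C (Dom C f) (Cod C g)" "(f \<bullet> p) \<bullet> i = f"
    using bp g far by simp_all
  ultimately have di: "d \<bullet> i = f"
    using add_zero_right[of "d \<bullet> i"] d bp by simp
  have "epic C d" using epic_of_comp[of i d] di f d bp by simp
  obtain k where k: "is_kernel C d k" using kernel_exists d by blast
  note ark = kernel_arrow[OF k]
  have "(d \<bullet> k) \<boxplus> ((g \<bullet> q) \<bullet> k) = (f \<bullet> p) \<bullet> k"
    using comp_add_left[of k d "g \<bullet> q"] d bp g ark by simp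
  then have sq: "f \<bullet> (p \<bullet> k) = g \<bullet> (q \<bullet> k)"
    using add_zero_left[of "(g \<bullet> q) \<bullet> k"] d bp g ark far by simp
  have "epic C (q \<bullet> k)"
  proof (rule epicI)
    show "q \<bullet> k \<in> Ar C" using bp ark d by simp
    fix u assume "u \<in> Ar C" "Dom C u = Cod C (q \<bullet> k)"
      "u \<bullet> (q \<bullet> k) = Zero C (Dom C (q \<bullet> k)) (Cod C u)"
    then have u: "u \<in> Ar C" "Dom C u = Dom C g" "(u \<bullet> q) \<bullet> k = Zero C (Dom C k) (Cod C u)"
      using bp ark d by simp_all
    then obtain v where v: "v \<in> Ar C" "Dom C v = Cod C g" "Cod C v = Cod C u" "v \<bullet> d = u \<bullet> q"
      using epic_factor_through_kernel[OF \<open>epic C d\<close> k, of "u \<bullet> q"] bp d by auto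
    have "v \<bullet> f = (v \<bullet> d) \<bullet> i" using v(1-3) d bp di by simp
    also have "\<dots> = Zero C (Dom C f) (Cod C v)" unfolding v(4) using u(1,2) v(3) bp far by simp
    finally have vf: "v \<bullet> f = Zero C (Dom C f) (Cod C v)" .
    have "v = Zero C (Cod C g) (Cod C u)"
      by (rule epic_zeroD[OF f]) (use v(1-3) vf fg in simp_all)
    then have "u \<bullet> q = Zero C P (Cod C u)" using v u d by simp
    then have "(u \<bullet> q) \<bullet> j = Zero C (Dom C g) (Cod C u)" using u bp by simp
    then show "u = Zero C (Cod C (q \<bullet> k)) (Cod C u)" using u(1,2) bp ark d by simp
  qed
  then show ?thesis
    using sq bp ark d by (intro exI[of _ "q \<bullet> k"] exI[of _ "p \<bullet> k"]) simp
qed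

text \<open>
  If \<open>u\<close> kills \<open>a\<close>, then \<open>f\<close> factors through the subobject \<open>m k\<close> where \<open>k\<close> is the kernel of \<open>u\<close>.
  This subobject is the kernel of some \<open>v\<close>, which kills \<open>f\<close> and thus factors through the cokernel
  of \<open>f\<close>; so \<open>v\<close> kills \<open>m\<close>, and \<open>m\<close> factors through \<open>m k\<close>.
\<close>

lemma image_factor_epic:
  assumes c: "is_cokernel C f c" and m: "is_kernel C c m"
    and a: "a \<in> Ar C" "Cod C a = Dom C m" "m \<bullet> a = f"
  shows "epic C a"
proof (rule epicI)
  note ar = cokernel_arrow[OF c] kernel_arrow[OF m]
  show "a \<in> Ar C" by (rule a)
  fix u assume u: "u \<in> Ar C" "Dom C u = Cod C a" "u \<bullet> a = Zero C (Dom C a) (Cod C u)"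
  obtain k where k: "is_kernel C u k" using kernel_exists u by blast
  note ark = kernel_arrow[OF k]
  obtain b where b: "b \<in> Ar C" "Dom C b = Dom C a" "Cod C b = Dom C k" "k \<bullet> b = a"
    using kernel_factor[OF k, of a] a u by auto
  have "monic C (m \<bullet> k)"
    using monic_comp[OF kernel_monic[OF k] kernel_monic[OF m]] ark u(2) a(2) by simp
  then obtain v where v: "is_kernel C v (m \<bullet> k)" using monic_normal by blast
  note arv = kernel_arrow[OF v]
  have mk: "m \<in> Ar C" "Cod C m = Dom C c" "k \<in> Ar C" "Cod C k = Dom C m" "Dom C c = Cod C f"
    using ar ark(2,3) u(2) a(2) by simp_all
  have vc: "Dom C v = Dom C c" using arv(3) mk by simp
  have "f = (m \<bullet> k) \<bullet> b" using b a(3) mk by auto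
  then have "v \<bullet> f = v \<bullet> ((m \<bullet> k) \<bullet> b)" by simp
  also have "\<dots> = (v \<bullet> (m \<bullet> k)) \<bullet> b"
    using b(1,3) mk(1-4) vc arv(1) by simp
  also have "\<dots> = Zero C (Dom C b) (Cod C v)"
    unfolding arv(4) using arv(1) b(1,3) mk(1-4) by simp
  also have "Dom C b = Dom C f"
    using b(2) a(1,2) mk(1) by (simp flip: a(3))
  finally obtain w where w: "w \<in> Ar C" "Dom C w = Cod C c" "Cod C w = Cod C v" "w \<bullet> c = v"
    using cokernel_factor[OF c arv(1)] vc mk(5) by auto
  have "v \<bullet> m = (w \<bullet> c) \<bullet> m" by (simp add: w(4))
  also have "\<dots> = w \<bullet> (c \<bullet> m)" using w(1,2) ar(2) mk(1,2) by simp
  also have "\<dots> = Zero C (Dom C m) (Cod C v)" using w(1-3) ar(8) mk(1) by simp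
  finally obtain s where s: "s \<in> Ar C" "Dom C s = Dom C m" "Cod C s = Dom C k" "(m \<bullet> k) \<bullet> s = m"
    using kernel_factor[OF v mk(1)] mk vc by auto
  \<comment> \<open>The kernel of \<open>u\<close> is all of the image, so \<open>u\<close> vanishes on it.\<close>
  have "m \<bullet> (k \<bullet> s) = m \<bullet> Idt C (Dom C m)" using s mk(1-4) by simp
  then have "k \<bullet> s = Idt C (Dom C m)"
    using monic_cancel[OF kernel_monic[OF m], of "k \<bullet> s" "Idt C (Dom C m)"] s(1-3) mk(1-4)
    by simp
  then have "u = u \<bullet> (k \<bullet> s)" using u a by simp
  also have "\<dots> = (u \<bullet> k) \<bullet> s"
    by (rule comp_assoc[symmetric]) (use u(1,2) s(1-3) ark(2,3) a(2) in simp_all)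
  also have "\<dots> = Zero C (Cod C a) (Cod C u)" unfolding ark(4) using s(1-3) u ark a by simp
  finally show "u = Zero C (Cod C a) (Cod C u)" .
qed

lemma image_factorization:
  assumes f: "f \<in> Ar C"
  shows "\<exists>m a. monic C m \<and> epic C a \<and> Cod C a = Dom C m \<and> m \<bullet> a = f"
proof -
  obtain c where c: "is_cokernel C f c" using cokernel_exists f by blast
  note arc = cokernel_arrow[OF c]
  obtain m where m: "is_kernel C c m" using kernel_exists arc by blast
  obtain a where "a \<in> Ar C" "Cod C a = Dom C m" "m \<bullet> a = f"
    using kernel_factor[OF m f] arc by auto
  then show ?thesis using kernel_monic[OF m] image_factor_epic[OF c m] by blast
qed

text \<open>
  The element-wise form of exactness: every \<open>x\<close> killed by \<open>g\<close> lifts along \<open>f\<close> after a cover \<open>p\<close>.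
  For an exact pair, \<open>x\<close> factors through the image, onto which \<open>f\<close> is epic. Conversely, lifting the
  kernel \<open>m\<close> of \<open>g\<close> itself shows that the cokernel \<open>c\<close> of \<open>f\<close> kills \<open>m\<close>, while \<open>g\<close> factors through
  \<open>c\<close>; so \<open>c\<close> and \<open>g\<close> have the same kernel.
\<close>

lemma exact_at_iff:
  "exact_at C f g \<longleftrightarrow> f \<in> Ar C \<and> g \<in> Ar C \<and> Cod C f = Dom C g \<and>
    g \<bullet> f = Zero C (Dom C f) (Cod C g) \<and>
    (\<forall>x \<in> Ar C. Cod C x = Dom C g \<longrightarrow> g \<bullet> x = Zero C (Dom C x) (Cod C g) \<longrightarrow>
      (\<exists>p y. epic C p \<and> Cod C p = Dom C x \<and>
        y \<in> Ar C \<and> Dom C y = Dom C p \<and> Cod C y = Dom C f \<and> f \<bullet> y = x \<bullet> p))"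
  (is "_ \<longleftrightarrow> ?R")
proof
  assume "exact_at C f g"
  then obtain m c where fg: "f \<in> Ar C" "g \<in> Ar C" "Cod C f = Dom C g"
    and c: "is_cokernel C f c" and m: "is_kernel C c m" "is_kernel C g m"
    unfolding exact_at_def is_image_def by blast
  note ar = cokernel_arrow[OF c] kernel_arrow[OF m(1)] kernel_arrow[OF m(2)]
  obtain a where a: "a \<in> Ar C" "Dom C a = Dom C f" "Cod C a = Dom C m" "m \<bullet> a = f"
    using kernel_factor[OF m(1), of f] ar by auto
  have "epic C a" using image_factor_epic[OF c m(1)] a by blast
  have "g \<bullet> f = (g \<bullet> m) \<bullet> a" using a fg ar(5-7) by auto
  also have "\<dots> = Zero C (Dom C f) (Cod C g)"
    unfolding \<open>g \<bullet> m = Zero C (Dom C m) (Cod C g)\<close> using a fg by simp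
  finally have gf: "g \<bullet> f = Zero C (Dom C f) (Cod C g)" .
  have "\<exists>p y. epic C p \<and> Cod C p = Dom C x \<and>
      y \<in> Ar C \<and> Dom C y = Dom C p \<and> Cod C y = Dom C f \<and> f \<bullet> y = x \<bullet> p"
    if x: "x \<in> Ar C" "Cod C x = Dom C g" "g \<bullet> x = Zero C (Dom C x) (Cod C g)" for x
  proof -
    obtain t where t: "t \<in> Ar C" "Dom C t = Dom C x" "Cod C t = Dom C m" "m \<bullet> t = x"
      using kernel_factor[OF m(2) x] by blast
    obtain p y where py: "epic C p" "Cod C p = Dom C x"
      "y \<in> Ar C" "Dom C y = Dom C p" "Cod C y = Dom C f" "a \<bullet> y = t \<bullet> p"
      using pullback_of_epic[OF \<open>epic C a\<close>, of t] t a by auto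
    have "f \<bullet> y = m \<bullet> (a \<bullet> y)" using a py(3-5) ar(6) by auto
    also have "\<dots> = x \<bullet> p" unfolding py(6) using t py(1,2) epic_arrow ar(6) by auto
    finally show ?thesis using py by blast
  qed
  with fg gf show ?R by blast
next
  assume R: ?R
  then have fg: "f \<in> Ar C" "g \<in> Ar C" "Cod C f = Dom C g"
    "g \<bullet> f = Zero C (Dom C f) (Cod C g)" by auto
  obtain m where m: "is_kernel C g m" using kernel_exists fg by blast
  obtain c where c: "is_cokernel C f c" using cokernel_exists fg by blast
  note ar = cokernel_arrow[OF c] kernel_arrow[OF m]
  have "is_kernel C c m"
  proof (rule is_kernelI)
    show "c \<in> Ar C" "monic C m" "Cod C m = Dom C c"
      using ar kernel_monic[OF m] fg by auto
    obtain p y where py: "epic C p" "Cod C p = Dom C m"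
      "y \<in> Ar C" "Dom C y = Dom C p" "Cod C y = Dom C f" "f \<bullet> y = m \<bullet> p"
      using R ar(6-) by blast
    have "(c \<bullet> m) \<bullet> p = c \<bullet> (f \<bullet> y)"
      using py epic_arrow ar fg by simp
    also have "\<dots> = (c \<bullet> f) \<bullet> y" using py(3,5) ar(1-3) by simp
    also have "\<dots> = Zero C (Dom C p) (Cod C c)" using py(3-5) ar(1-4) by simp
    finally have cmp: "(c \<bullet> m) \<bullet> p = Zero C (Dom C p) (Cod C c)" .
    show "c \<bullet> m = Zero C (Dom C m) (Cod C c)"
      by (rule epic_zeroD[OF py(1)]) (use py(2) cmp ar fg in simp_all)
    fix x assume x: "x \<in> Ar C" "Cod C x = Dom C c" "c \<bullet> x = Zero C (Dom C x) (Cod C c)"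
    obtain v where v: "v \<in> Ar C" "Dom C v = Cod C c" "Cod C v = Cod C g" "v \<bullet> c = g"
      using cokernel_factor[OF c, of g] fg by auto
    have "g \<bullet> x = v \<bullet> (c \<bullet> x)" using v ar x by auto
    also have "\<dots> = Zero C (Dom C x) (Cod C g)" using v ar x by simp
    finally show "\<exists>y. y \<in> Ar C \<and> Dom C y = Dom C x \<and> Cod C y = Dom C m \<and> m \<bullet> y = x"
      using kernel_factor[OF m, of x] x ar fg by simp
  qed
  then show "exact_at C f g"
    using fg m c unfolding exact_at_def is_image_def by blast
qed

lemma exact_at_zeroD:
  assumes "exact_at C f g"
  shows "f \<in> Ar C" "g \<in> Ar C" "Cod C f = Dom C g" "g \<bullet> f = Zero C (Dom C f) (Cod C g)"
  using assms by (simp_all add: exact_at_iff)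

lemma exact_at_lift:
  assumes "exact_at C f g" "x \<in> Ar C" "Cod C x = Dom C g" "g \<bullet> x = Zero C (Dom C x) (Cod C g)"
  shows "\<exists>p y. epic C p \<and> Cod C p = Dom C x \<and>
    y \<in> Ar C \<and> Dom C y = Dom C p \<and> Cod C y = Dom C f \<and> f \<bullet> y = x \<bullet> p"
  using assms by (simp add: exact_at_iff)

lemma right_exact_seq_iff: "right_exact_seq C f g \<longleftrightarrow> exact_at C f g \<and> epic C g"
proof -
  have "epic C g" if z: "is_zero_object C Z" and ex: "exact_at C g (Zero C (Cod C g) Z)" for Z
  proof -
    have ar: "g \<in> Ar C" "Z \<in> Ob C" using exact_at_zeroD[OF ex] z by (auto simp: is_zero_object_def)
    obtain p y where py: "epic C p" "Cod C p = Cod C g"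
      "y \<in> Ar C" "Dom C y = Dom C p" "Cod C y = Dom C g" "g \<bullet> y = Idt C (Cod C g) \<bullet> p"
      using exact_at_lift[OF ex, of "Idt C (Cod C g)"] ar by auto
    then show ?thesis using epic_of_comp[of y g] ar epic_arrow[OF py(1)] by simp
  qed
  moreover have "\<exists>Z. is_zero_object C Z \<and> exact_at C g (Zero C (Cod C g) Z)" if g: "epic C g"
  proof -
    obtain Z where Z: "is_zero_object C Z" using zero_object_exists by blast
    then have ZOb: "Z \<in> Ob C" by (simp add: is_zero_object_def)
    note ar = epic_arrow[OF g]
    have "exact_at C g (Zero C (Cod C g) Z)"
      unfolding exact_at_iff using ZOb ar pullback_of_epic[OF g] by auto
    then show ?thesis using Z by blast
  qed
  ultimately show ?thesis unfolding right_exact_seq_def by blast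
qed

lemma cokernel_right_exact_seq:
  assumes c: "is_cokernel C f c"
  shows "right_exact_seq C f c"
proof -
  note ar = cokernel_arrow[OF c]
  obtain m where m: "is_kernel C c m" using kernel_exists ar by blast
  then have "exact_at C f c" using c ar unfolding exact_at_def is_image_def by auto
  then show ?thesis using cokernel_epic[OF c] by (simp add: right_exact_seq_iff)
qed

lemma left_exact_seq_monic:
  assumes "left_exact_seq C f g"
  shows "monic C f"
proof -
  obtain Z where Z: "is_zero_object C Z" and ex: "exact_at C (Zero C Z (Dom C f)) f"
    using assms unfolding left_exact_seq_def by blast
  have ar: "Z \<in> Ob C" "f \<in> Ar C" using Z exact_at_zeroD[OF ex] by (auto simp: is_zero_object_def)
  show ?thesis
  proof (rule monicI[OF ar(2)])
    fix x assume x: "x \<in> Ar C" "Cod C x = Dom C f" "f \<bullet> x = Zero C (Dom C x) (Cod C f)"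
    obtain p y where py: "epic C p" "Cod C p = Dom C x" "y \<in> Ar C" "Dom C y = Dom C p"
      "Cod C y = Z" "Zero C Z (Dom C f) \<bullet> y = x \<bullet> p"
      using exact_at_lift[OF ex x] ar by auto
    then have xp: "x \<bullet> p = Zero C (Dom C p) (Cod C x)" using x(2) ar by simp
    show "x = Zero C (Dom C x) (Dom C f)"
      by (rule epic_zeroD[OF py(1)]) (use x(1,2) xp py(2) in simp_all)
  qed
qed

lemma epic_right_exact_seq:
  assumes e: "epic C e" and k: "is_kernel C e k"
  shows "right_exact_seq C k e"
  unfolding right_exact_seq_iff exact_at_iff
proof (intro conjI ballI impI)
  fix x assume x: "x \<in> Ar C" "Cod C x = Dom C e" "e \<bullet> x = Zero C (Dom C x) (Cod C e)"
  obtain y where "y \<in> Ar C" "Dom C y = Dom C x" "Cod C y = Dom C k" "k \<bullet> y = x"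
    using kernel_factor[OF k x] by blast
  then show "\<exists>p y. epic C p \<and> Cod C p = Dom C x \<and>
      y \<in> Ar C \<and> Dom C y = Dom C p \<and> Cod C y = Dom C k \<and> k \<bullet> y = x \<bullet> p"
    using x identity_epic[of "Dom C x"] by (intro exI[of _ "Idt C (Dom C x)"] exI[of _ y]) simp
qed (use e kernel_arrow[OF k] in auto)

text \<open>
  A right-exact functor preserves zero arrows because of this sequence: its value on the sequence
  again composes to zero, and its value on the identity is an identity.
\<close>

lemma zero_identity_right_exact_seq:
  assumes "A \<in> Ob C" "B \<in> Ob C"
  shows "right_exact_seq C (Zero C A B) (Idt C B)"
  unfolding right_exact_seq_iff exact_at_iff
proof (intro conjI ballI impI)
  fix x assume "x \<in> Ar C" "Cod C x = Dom C (Idt C B)"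
    "Idt C B \<bullet> x = Zero C (Dom C x) (Cod C (Idt C B))"
  then have x: "x \<in> Ar C" "x \<bullet> Idt C (Dom C x) = Zero C (Dom C x) B"
    using assms by simp_all
  then show "\<exists>p y. epic C p \<and> Cod C p = Dom C x \<and> y \<in> Ar C \<and> Dom C y = Dom C p \<and>
      Cod C y = Dom C (Zero C A B) \<and> Zero C A B \<bullet> y = x \<bullet> p"
    using x(1) assms identity_epic[of "Dom C x"]
    by (intro exI[of _ "Idt C (Dom C x)"] exI[of _ "Zero C (Dom C x) A"]) simp
qed (use assms identity_epic in auto)

end


section \<open>Right-exact functors\<close>

locale right_exact_functor = C: abelian_category C + D: abelian_category D
  for C :: "('o, 'm, 'c) acat_scheme" and D :: "('p, 'n, 'd) acat_scheme" +
  fixes F :: "('o, 'm, 'p, 'n) fctr"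
  assumes F_right_exact: "right_exact C D F"
begin

lemma F_functor: "covariant_functor C D F"
  using F_right_exact by (simp add: right_exact_def)

lemma F_obj [simp]: "A \<in> Ob C \<Longrightarrow> obj_map F A \<in> Ob D"
  using F_functor by (simp add: covariant_functor_def)

lemma F_arrow [simp]:
  assumes "f \<in> Ar C"
  shows "arr_map F f \<in> Ar D" "Dom D (arr_map F f) = obj_map F (Dom C f)"
    "Cod D (arr_map F f) = obj_map F (Cod C f)"
  using F_functor assms by (auto simp: covariant_functor_def Hom_iff)

lemma F_identity: "A \<in> Ob C \<Longrightarrow> arr_map F (Idt C A) = Idt D (obj_map F A)"
  using F_functor by (simp add: covariant_functor_def)

lemma F_comp:
  "\<lbrakk>f \<in> Ar C; g \<in> Ar C; Cod C f = Dom C g\<rbrakk>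
    \<Longrightarrow> arr_map F (g \<bullet>\<^bsub>C\<^esub> f) = arr_map F g \<bullet>\<^bsub>D\<^esub> arr_map F f"
  using F_functor by (auto simp: covariant_functor_def Hom_iff)

lemma F_exact: "right_exact_seq C f g \<Longrightarrow> exact_at D (arr_map F f) (arr_map F g)"
  using F_right_exact by (simp add: right_exact_def D.right_exact_seq_iff)

lemma F_epic:
  assumes "epic C e"
  shows "epic D (arr_map F e)"
proof -
  obtain k where "is_kernel C e k"
    using C.kernel_exists C.epic_arrow[OF assms] by blast
  then show ?thesis
    using C.epic_right_exact_seq[OF assms] F_right_exact
    by (auto simp: right_exact_def D.right_exact_seq_iff)
qed

lemma F_zero:
  assumes "A \<in> Ob C" "B \<in> Ob C"
  shows "arr_map F (Zero C A B) = Zero D (obj_map F A) (obj_map F B)"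
  using D.exact_at_zeroD(4)[OF F_exact[OF C.zero_identity_right_exact_seq[OF assms]]] assms
  by (simp add: F_identity)

lemma F_comp_kills:
  assumes "m \<in> Ar C" "h \<in> Ar C" "Cod C m = Dom C h"
    and "x \<in> Ar D" "Cod D x = obj_map F (Dom C m)"
    and "arr_map F m \<bullet>\<^bsub>D\<^esub> x = Zero D (Dom D x) (obj_map F (Cod C m))"
  shows "arr_map F (h \<bullet>\<^bsub>C\<^esub> m) \<bullet>\<^bsub>D\<^esub> x = Zero D (Dom D x) (obj_map F (Cod C h))"
  using assms by (simp add: F_comp)

end

section \<open>The injective stabilization as a kernel functor\<close>

locale stabilized_functor = right_exact_functor C D F
  for C :: "('o, 'm, 'c) acat_scheme" and D :: "('p, 'n, 'd) acat_scheme"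
    and F :: "('o, 'm, 'p, 'n) fctr" +
  fixes \<iota> \<delta> :: "'o \<Rightarrow> 'm"
  assumes copresentation: "B \<in> Ob C \<Longrightarrow> injective_copresentation C B (\<iota> B) (\<delta> B)"
begin

abbreviation stab :: "('o, 'm, 'p, 'n) fctr" where
  "stab \<equiv> injective_stabilization C D \<iota> \<delta> F"

text \<open>The inclusion of the stabilization at \<open>B\<close> into \<open>F(B)\<close>.\<close>

abbreviation \<kappa> :: "'o \<Rightarrow> 'n" where
  "\<kappa> B \<equiv> ker D (rho C D \<iota> \<delta> F B)"

lemma iota_arrow [simp]:
  assumes "B \<in> Ob C"
  shows "\<iota> B \<in> Ar C" "Dom C (\<iota> B) = B"
  using copresentation[OF assms] C.left_exact_seq_monic C.monic_arrow
  unfolding injective_copresentation_def by blast+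

lemma iota_monic:
  assumes "B \<in> Ob C"
  shows "monic C (\<iota> B)"
  using copresentation[OF assms] C.left_exact_seq_monic
  unfolding injective_copresentation_def by blast

lemma iota_injective:
  assumes "B \<in> Ob C"
  shows "is_injective C (Cod C (\<iota> B))"
  using copresentation[OF assms] unfolding injective_copresentation_def by blast

lemma kappa_kernel:
  assumes B: "B \<in> Ob C"
  shows "is_kernel D (arr_map F (\<iota> B)) (\<kappa> B)"
proof -
  have "exact_at C (\<iota> B) (\<delta> B)"
    using copresentation[OF B] by (simp add: injective_copresentation_def left_exact_seq_def)
  note d = C.exact_at_zeroD[OF this]
  define j where "j = ker D (arr_map F (\<delta> B))"
  have j: "is_kernel D (arr_map F (\<delta> B)) j"
    unfolding j_def using d by (intro D.ker_is_kernel) simp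
  have "arr_map F (\<delta> B) \<bullet>\<^bsub>D\<^esub> arr_map F (\<iota> B) = Zero D (obj_map F B) (obj_map F (Cod C (\<delta> B)))"
    using d B by (simp add: F_zero flip: F_comp)
  then have "\<exists>!r. r \<in> Hom D (obj_map F B) (Dom D j) \<and> j \<bullet>\<^bsub>D\<^esub> r = arr_map F (\<iota> B)"
    using j B d by (simp add: is_kernel_def Hom_iff)
  from theI'[OF this]
  have rho: "rho C D \<iota> \<delta> F B \<in> Hom D (obj_map F B) (Dom D j)"
      "j \<bullet>\<^bsub>D\<^esub> rho C D \<iota> \<delta> F B = arr_map F (\<iota> B)"
    by (simp_all add: rho_def R0_def Let_def flip: j_def)
  then have "is_kernel D (rho C D \<iota> \<delta> F B) (\<kappa> B)"
    by (intro D.ker_is_kernel) (simp add: Hom_iff)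
  from D.kernel_of_monic_comp[OF this D.kernel_monic[OF j]] rho show ?thesis
    by (simp add: Hom_iff)
qed

lemma kappa_arrow [simp]:
  assumes "B \<in> Ob C"
  shows "\<kappa> B \<in> Ar D" "Cod D (\<kappa> B) = obj_map F B"
  using D.kernel_arrow[OF kappa_kernel[OF assms]] assms by simp_all

lemma kappa_killed:
  assumes "B \<in> Ob C"
  shows "arr_map F (\<iota> B) \<bullet>\<^bsub>D\<^esub> \<kappa> B = Zero D (Dom D (\<kappa> B)) (obj_map F (Cod C (\<iota> B)))"
  using D.kernel_arrow(4)[OF kappa_kernel[OF assms]] assms by simp

lemma kappa_monic: "B \<in> Ob C \<Longrightarrow> monic D (\<kappa> B)"
  using D.kernel_monic[OF kappa_kernel] .

lemma kappa_factor:
  assumes "B \<in> Ob C" "x \<in> Ar D" "Cod D x = obj_map F B"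
    "arr_map F (\<iota> B) \<bullet>\<^bsub>D\<^esub> x = Zero D (Dom D x) (obj_map F (Cod C (\<iota> B)))"
  shows "\<exists>y. y \<in> Ar D \<and> Dom D y = Dom D x \<and> Cod D y = Dom D (\<kappa> B) \<and> \<kappa> B \<bullet>\<^bsub>D\<^esub> y = x"
  using D.kernel_factor[OF kappa_kernel[OF assms(1)] assms(2)] assms by simp

text \<open>
  Every arrow from \<open>B\<close> to an injective object factors through \<open>\<iota>\<^sub>B\<close>, and \<open>\<iota>\<^sub>B\<close> factors through every
  monic arrow out of \<open>B\<close>. Together the next two facts make membership in the stabilization
  independent of the chosen copresentation.
\<close>

lemma killed_in_injective:
  assumes h: "h \<in> Ar C" "is_injective C (Cod C h)" and B: "Dom C h = B"
    and x: "x \<in> Ar D" "Cod D x = obj_map F B"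
      "arr_map F (\<iota> B) \<bullet>\<^bsub>D\<^esub> x = Zero D (Dom D x) (obj_map F (Cod C (\<iota> B)))"
  shows "arr_map F h \<bullet>\<^bsub>D\<^esub> x = Zero D (Dom D x) (obj_map F (Cod C h))"
proof -
  have BOb: "B \<in> Ob C" using h B by auto
  obtain u where u: "u \<in> Ar C" "Dom C u = Cod C (\<iota> B)" "Cod C u = Cod C h" "u \<bullet>\<^bsub>C\<^esub> \<iota> B = h"
    using C.injective_extend[OF h(2) iota_monic[OF BOb] h(1)] B BOb by auto
  show ?thesis
    using F_comp_kills[of "\<iota> B" u x] u x BOb by simp
qed

lemma killed_of_monic:
  assumes m: "monic C m" and B: "Dom C m = B"
    and x: "x \<in> Ar D" "Cod D x = obj_map F B"
      "arr_map F m \<bullet>\<^bsub>D\<^esub> x = Zero D (Dom D x) (obj_map F (Cod C m))"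
  shows "arr_map F (\<iota> B) \<bullet>\<^bsub>D\<^esub> x = Zero D (Dom D x) (obj_map F (Cod C (\<iota> B)))"
proof -
  note mar = C.monic_arrow[OF m]
  have BOb: "B \<in> Ob C" using mar B by auto
  obtain u where u: "u \<in> Ar C" "Dom C u = Cod C m" "Cod C u = Cod C (\<iota> B)" "u \<bullet>\<^bsub>C\<^esub> m = \<iota> B"
    using C.injective_extend[OF iota_injective[OF BOb] m, of "\<iota> B"] B BOb by auto
  show ?thesis
    using F_comp_kills[of m u x] u x mar B by simp
qed

lemma stab_obj: "obj_map stab B = Dom D (\<kappa> B)"
  by (simp add: injective_stabilization_def nat_ker_def)

lemma stab_arrow_Hom:
  assumes f: "f \<in> Ar C"
  shows "arr_map stab f \<in> Hom D (Dom D (\<kappa> (Dom C f))) (Dom D (\<kappa> (Cod C f))) \<and>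
    \<kappa> (Cod C f) \<bullet>\<^bsub>D\<^esub> arr_map stab f = arr_map F f \<bullet>\<^bsub>D\<^esub> \<kappa> (Dom C f)"
proof -
  let ?A = "Dom C f" and ?B = "Cod C f"
  have AB: "?A \<in> Ob C" "?B \<in> Ob C" using f by simp_all
  have "arr_map F (\<iota> ?B \<bullet>\<^bsub>C\<^esub> f) \<bullet>\<^bsub>D\<^esub> \<kappa> ?A
      = Zero D (Dom D (\<kappa> ?A)) (obj_map F (Cod C (\<iota> ?B)))"
    using killed_in_injective[of "\<iota> ?B \<bullet>\<^bsub>C\<^esub> f" ?A "\<kappa> ?A"] f AB iota_injective[OF AB(2)]
      kappa_killed[OF AB(1)]
    by simp
  then have "arr_map F (\<iota> ?B) \<bullet>\<^bsub>D\<^esub> (arr_map F f \<bullet>\<^bsub>D\<^esub> \<kappa> ?A)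
      = Zero D (Dom D (\<kappa> ?A)) (obj_map F (Cod C (\<iota> ?B)))"
    using f AB by (simp add: F_comp)
  then have "\<exists>!g. g \<in> Hom D (Dom D (\<kappa> ?A)) (Dom D (\<kappa> ?B)) \<and>
      \<kappa> ?B \<bullet>\<^bsub>D\<^esub> g = arr_map F f \<bullet>\<^bsub>D\<^esub> \<kappa> ?A"
    using kappa_kernel[OF AB(2)] f AB by (simp add: is_kernel_def Hom_iff)
  from theI'[OF this] show ?thesis
    by (simp add: injective_stabilization_def nat_ker_def Let_def)
qed

lemma stab_arrow [simp]:
  assumes "f \<in> Ar C"
  shows "arr_map stab f \<in> Ar D" "Dom D (arr_map stab f) = Dom D (\<kappa> (Dom C f))"
    "Cod D (arr_map stab f) = Dom D (\<kappa> (Cod C f))"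
  using stab_arrow_Hom[OF assms] by (auto simp: Hom_iff)

lemma stab_square:
  "f \<in> Ar C \<Longrightarrow> \<kappa> (Cod C f) \<bullet>\<^bsub>D\<^esub> arr_map stab f = arr_map F f \<bullet>\<^bsub>D\<^esub> \<kappa> (Dom C f)"
  using stab_arrow_Hom by blast

lemma stab_square_comp:
  assumes "f \<in> Ar C" "x \<in> Ar D" "Cod D x = Dom D (\<kappa> (Dom C f))"
  shows "\<kappa> (Cod C f) \<bullet>\<^bsub>D\<^esub> (arr_map stab f \<bullet>\<^bsub>D\<^esub> x) = arr_map F f \<bullet>\<^bsub>D\<^esub> (\<kappa> (Dom C f) \<bullet>\<^bsub>D\<^esub> x)"
proof -
  have "\<kappa> (Cod C f) \<bullet>\<^bsub>D\<^esub> (arr_map stab f \<bullet>\<^bsub>D\<^esub> x) = (\<kappa> (Cod C f) \<bullet>\<^bsub>D\<^esub> arr_map stab f) \<bullet>\<^bsub>D\<^esub> x"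
    using assms by simp
  also have "\<dots> = arr_map F f \<bullet>\<^bsub>D\<^esub> (\<kappa> (Dom C f) \<bullet>\<^bsub>D\<^esub> x)"
    unfolding stab_square[OF assms(1)] using assms by simp
  finally show ?thesis .
qed

lemma stab_comp:
  assumes "f \<in> Ar C" "g \<in> Ar C" "Cod C f = Dom C g"
  shows "arr_map stab (g \<bullet>\<^bsub>C\<^esub> f) = arr_map stab g \<bullet>\<^bsub>D\<^esub> arr_map stab f"
proof (rule D.monic_cancel[OF kappa_monic])
  have "\<kappa> (Cod C g) \<bullet>\<^bsub>D\<^esub> (arr_map stab g \<bullet>\<^bsub>D\<^esub> arr_map stab f)
      = arr_map F g \<bullet>\<^bsub>D\<^esub> (\<kappa> (Cod C f) \<bullet>\<^bsub>D\<^esub> arr_map stab f)"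
    using stab_square_comp[of g "arr_map stab f"] assms by simp
  also have "\<dots> = arr_map F g \<bullet>\<^bsub>D\<^esub> (arr_map F f \<bullet>\<^bsub>D\<^esub> \<kappa> (Dom C f))"
    using stab_square assms(1) by simp
  also have "\<dots> = \<kappa> (Cod C g) \<bullet>\<^bsub>D\<^esub> arr_map stab (g \<bullet>\<^bsub>C\<^esub> f)"
    using stab_square[of "g \<bullet>\<^bsub>C\<^esub> f"] assms by (simp add: F_comp)
  finally show "\<kappa> (Cod C g) \<bullet>\<^bsub>D\<^esub> arr_map stab (g \<bullet>\<^bsub>C\<^esub> f)
      = \<kappa> (Cod C g) \<bullet>\<^bsub>D\<^esub> (arr_map stab g \<bullet>\<^bsub>D\<^esub> arr_map stab f)" ..
qed (use assms in simp_all)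

lemma stab_identity:
  assumes "A \<in> Ob C"
  shows "arr_map stab (Idt C A) = Idt D (Dom D (\<kappa> A))"
proof (rule D.monic_cancel[OF kappa_monic[OF assms]])
  show "\<kappa> A \<bullet>\<^bsub>D\<^esub> arr_map stab (Idt C A) = \<kappa> A \<bullet>\<^bsub>D\<^esub> Idt D (Dom D (\<kappa> A))"
    using stab_square[of "Idt C A"] assms by (simp add: F_identity)
qed (use assms in simp_all)

lemma stab_functor: "covariant_functor C D stab"
  unfolding covariant_functor_def
proof (intro conjI allI ballI)
  fix A assume "A \<in> Ob C"
  then show "obj_map stab A \<in> Ob D" "arr_map stab (Idt C A) = Idt D (obj_map stab A)"
    by (simp_all add: stab_obj stab_identity)
next
  fix A B f assume "f \<in> Hom C A B"
  then show "arr_map stab f \<in> Hom D (obj_map stab A) (obj_map stab B)"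
    by (auto simp: Hom_iff stab_obj)
next
  fix X Y Z f g assume "f \<in> Hom C X Y" "g \<in> Hom C Y Z"
  then show "arr_map stab (g \<bullet>\<^bsub>C\<^esub> f) = arr_map stab g \<bullet>\<^bsub>D\<^esub> arr_map stab f"
    by (auto simp: Hom_iff stab_comp)
qed

end


section \<open>Epimorphisms, exactness and property A\<close>

context stabilized_functor
begin

text \<open>
  Below, \<open>q : I \<rightarrow> I/K\<close> is the quotient by the kernel \<open>k : K \<rightarrow> B\<close> of \<open>e\<close> embedded in the injective
  \<open>I\<close> by \<open>\<iota>\<^sub>B\<close>, and \<open>c\<close> is the map from \<open>B' = B/K\<close> to \<open>I/K\<close>. The element of the stabilization at
  \<open>B'\<close> that gets lifted is the generic one, \<open>\<kappa> B'\<close>: that it lifts after a cover is precisely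
  surjectivity.
\<close>

lemma stab_epic_of_property_A:
  assumes enough: "enough_injectives C"
    and A: "\<And>X. cosyzygy_object C X \<Longrightarrow> property_A C D F X"
    and e: "epic C e"
  shows "epic D (arr_map stab e)"
proof -
  let ?B = "Dom C e" and ?B' = "Cod C e"
  have ar: "e \<in> Ar C" "?B \<in> Ob C" "?B' \<in> Ob C" using C.epic_arrow[OF e] by simp_all
  obtain k where k: "is_kernel C e k" using C.kernel_exists ar by blast
  note ark = C.kernel_arrow[OF k]
  let ?m = "\<iota> ?B"
  have mk: "?m \<bullet>\<^bsub>C\<^esub> k \<in> Ar C" "Dom C (?m \<bullet>\<^bsub>C\<^esub> k) = Dom C k" "Cod C (?m \<bullet>\<^bsub>C\<^esub> k) = Cod C ?m"
    using ar ark by simp_all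
  obtain q where q: "is_cokernel C (?m \<bullet>\<^bsub>C\<^esub> k) q" using C.cokernel_exists mk by blast
  have qe: "epic C q" and arq: "q \<in> Ar C" "Dom C q = Cod C ?m"
    using C.cokernel_epic[OF q] C.cokernel_arrow[OF q] mk by simp_all
  have qmk: "q \<bullet>\<^bsub>C\<^esub> (?m \<bullet>\<^bsub>C\<^esub> k) = Zero C (Dom C k) (Cod C q)"
    using C.cokernel_arrow(4)[OF q] mk by simp
  have "cosyzygy_object C (Cod C q)"
    unfolding cosyzygy_object_def Hom_iff using qe arq iota_injective ar by blast
  then have PA: "property_A C D F (Cod C q)" by (rule A)
  obtain c where c: "c \<in> Ar C" "Dom C c = ?B'" "Cod C c = Cod C q" "c \<bullet>\<^bsub>C\<^esub> e = q \<bullet>\<^bsub>C\<^esub> ?m"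
    using C.epic_factor_through_kernel[OF e k, of "q \<bullet>\<^bsub>C\<^esub> ?m"] arq ar ark qmk by auto
  obtain n where n: "monic C n" "Dom C n = Cod C q" "is_injective C (Cod C n)"
    using enough arq unfolding enough_injectives_def by (meson C.endpoints(2))
  have arn: "n \<in> Ar C" using C.monic_arrow n by blast
  have Fn: "monic D (arr_map F n)"
    using PA n unfolding property_A_def by blast
  let ?x = "\<kappa> ?B'"
  \<comment> \<open>\<open>n c\<close> ends in an injective object, so it kills the stabilization; property A cancels \<open>n\<close>.\<close>
  have "arr_map F n \<bullet>\<^bsub>D\<^esub> (arr_map F c \<bullet>\<^bsub>D\<^esub> ?x) = arr_map F (n \<bullet>\<^bsub>C\<^esub> c) \<bullet>\<^bsub>D\<^esub> ?x"
    using arn c n ar by (simp add: F_comp)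
  also have "\<dots> = Zero D (Dom D ?x) (obj_map F (Cod C n))"
    using killed_in_injective[of "n \<bullet>\<^bsub>C\<^esub> c" ?B' ?x] n arn c ar kappa_killed[OF ar(3)] by simp
  finally have nx: "arr_map F n \<bullet>\<^bsub>D\<^esub> (arr_map F c \<bullet>\<^bsub>D\<^esub> ?x)
      = Zero D (Dom D ?x) (obj_map F (Cod C n))" .
  have cx: "arr_map F c \<bullet>\<^bsub>D\<^esub> ?x = Zero D (Dom D ?x) (obj_map F (Cod C q))"
    by (rule D.monic_zeroD[OF Fn]) (use nx c n arn ar in simp_all)
  obtain p y where py: "epic D p" "Cod D p = Dom D ?x" "y \<in> Ar D" "Dom D y = Dom D p"
    "Cod D y = obj_map F ?B" "arr_map F e \<bullet>\<^bsub>D\<^esub> y = ?x \<bullet>\<^bsub>D\<^esub> p"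
    using D.pullback_of_epic[OF F_epic[OF e], of ?x] ar by auto
  have arp: "p \<in> Ar D" using D.epic_arrow py by blast
  have "arr_map F q \<bullet>\<^bsub>D\<^esub> (arr_map F ?m \<bullet>\<^bsub>D\<^esub> y) = arr_map F (c \<bullet>\<^bsub>C\<^esub> e) \<bullet>\<^bsub>D\<^esub> y"
    unfolding c(4) using arq ar py by (simp add: F_comp)
  also have "\<dots> = arr_map F c \<bullet>\<^bsub>D\<^esub> (?x \<bullet>\<^bsub>D\<^esub> p)"
    using c(1-3) ar py by (simp add: F_comp)
  also have "\<dots> = (arr_map F c \<bullet>\<^bsub>D\<^esub> ?x) \<bullet>\<^bsub>D\<^esub> p"
    using c(1-3) ar py(2) arp by simp
  also have "\<dots> = Zero D (Dom D p) (obj_map F (Cod C q))"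
    unfolding cx using py(2) arp arq by simp
  finally have qmy: "arr_map F q \<bullet>\<^bsub>D\<^esub> (arr_map F ?m \<bullet>\<^bsub>D\<^esub> y)
      = Zero D (Dom D p) (obj_map F (Cod C q))" .
  have "right_exact_seq C (?m \<bullet>\<^bsub>C\<^esub> k) q"
    using C.cokernel_right_exact_seq[OF q] .
  note ex = F_exact[OF this]
  obtain p' z where pz: "epic D p'" "Cod D p' = Dom D p" "z \<in> Ar D" "Dom D z = Dom D p'"
    "Cod D z = obj_map F (Dom C k)"
    "arr_map F (?m \<bullet>\<^bsub>C\<^esub> k) \<bullet>\<^bsub>D\<^esub> z = (arr_map F ?m \<bullet>\<^bsub>D\<^esub> y) \<bullet>\<^bsub>D\<^esub> p'"
    using D.exact_at_lift[OF ex, of "arr_map F ?m \<bullet>\<^bsub>D\<^esub> y"] qmy mk arq ar py by auto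
  have arp': "p' \<in> Ar D" using D.epic_arrow pz by blast
  \<comment> \<open>\<open>y\<close> and \<open>F(k) z\<close> agree in \<open>F(I)\<close>, so their difference \<open>d\<close> lies in the stabilization at \<open>B\<close>;
    it has the same image as \<open>y\<close> because \<open>e k = 0\<close>.\<close>
  let ?kz = "arr_map F k \<bullet>\<^bsub>D\<^esub> z"
  have kz: "?kz \<in> Ar D" "Dom D ?kz = Dom D p'" "Cod D ?kz = obj_map F ?B"
    using ark(1-3) pz by simp_all
  have yp: "y \<bullet>\<^bsub>D\<^esub> p' \<in> Ar D" "Dom D (y \<bullet>\<^bsub>D\<^esub> p') = Dom D p'" "Cod D (y \<bullet>\<^bsub>D\<^esub> p') = obj_map F ?B"
    using py pz arp' by simp_all
  obtain d where d: "d \<in> Ar D" "Dom D d = Dom D p'" "Cod D d = obj_map F ?B"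
    "d \<boxplus>\<^bsub>D\<^esub> ?kz = y \<bullet>\<^bsub>D\<^esub> p'"
    using D.difference_exists[OF yp(1) kz(1)] yp kz by auto
  have "(arr_map F ?m \<bullet>\<^bsub>D\<^esub> d) \<boxplus>\<^bsub>D\<^esub> (arr_map F ?m \<bullet>\<^bsub>D\<^esub> ?kz) = arr_map F ?m \<bullet>\<^bsub>D\<^esub> (y \<bullet>\<^bsub>D\<^esub> p')"
    using D.comp_add_right[of d ?kz "arr_map F ?m"] d kz ar by simp
  also have "\<dots> = arr_map F ?m \<bullet>\<^bsub>D\<^esub> ?kz"
    using pz(6) pz(1-5) py(3-5) arp' ark(1-3) ar by (simp add: F_comp)
  finally have md: "arr_map F ?m \<bullet>\<^bsub>D\<^esub> d = Zero D (Dom D d) (obj_map F (Cod C ?m))"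
    by (rule D.add_eq_right_imp_zero[rotated 4]) (use d kz ar in simp_all)
  obtain w where w: "w \<in> Ar D" "Dom D w = Dom D p'" "Cod D w = Dom D (\<kappa> ?B)" "\<kappa> ?B \<bullet>\<^bsub>D\<^esub> w = d"
    using kappa_factor[OF ar(2) d(1) d(3) md] d by auto
  have "arr_map F e \<bullet>\<^bsub>D\<^esub> ?kz = arr_map F (e \<bullet>\<^bsub>C\<^esub> k) \<bullet>\<^bsub>D\<^esub> z"
    using pz ark(1-3) ar by (simp add: F_comp)
  also have "\<dots> = Zero D (Dom D p') (obj_map F ?B')"
    unfolding ark(4) using pz ark(1-3) ar by (simp add: F_zero)
  finally have ekz: "arr_map F e \<bullet>\<^bsub>D\<^esub> ?kz = Zero D (Dom D p') (obj_map F ?B')" .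
  have "(arr_map F e \<bullet>\<^bsub>D\<^esub> d) \<boxplus>\<^bsub>D\<^esub> (arr_map F e \<bullet>\<^bsub>D\<^esub> ?kz) = arr_map F e \<bullet>\<^bsub>D\<^esub> (y \<bullet>\<^bsub>D\<^esub> p')"
    using D.comp_add_right[of d ?kz "arr_map F e"] d kz ar by simp
  then have ed: "arr_map F e \<bullet>\<^bsub>D\<^esub> d = arr_map F e \<bullet>\<^bsub>D\<^esub> (y \<bullet>\<^bsub>D\<^esub> p')"
    unfolding ekz using D.add_zero_right[of "arr_map F e \<bullet>\<^bsub>D\<^esub> d"] d(1-3) ar by simp
  have "?x \<bullet>\<^bsub>D\<^esub> (arr_map stab e \<bullet>\<^bsub>D\<^esub> w) = arr_map F e \<bullet>\<^bsub>D\<^esub> d"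
    using stab_square_comp[of e w] w ar by simp
  also have "\<dots> = (arr_map F e \<bullet>\<^bsub>D\<^esub> y) \<bullet>\<^bsub>D\<^esub> p'"
    unfolding ed using py(3-5) pz(2) arp' ar by simp
  also have "\<dots> = ?x \<bullet>\<^bsub>D\<^esub> (p \<bullet>\<^bsub>D\<^esub> p')"
    unfolding py(6) using py(2) pz(2) arp arp' ar by simp
  finally have "arr_map stab e \<bullet>\<^bsub>D\<^esub> w = p \<bullet>\<^bsub>D\<^esub> p'"
    using D.monic_cancel[OF kappa_monic[OF ar(3)], of "arr_map stab e \<bullet>\<^bsub>D\<^esub> w" "p \<bullet>\<^bsub>D\<^esub> p'"]
      w(1-3) ar py(2) pz(2) arp arp' by simp
  then show ?thesis
    using D.epic_of_comp[of w "arr_map stab e"] D.epic_comp[OF pz(1) py(1) pz(2)] w(1-3) ar by simp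
qed

text \<open>
  Factor \<open>f = i a\<close> through its image. A lift \<open>y\<close> of \<open>x\<close> to the source of \<open>F(f)\<close> need not lie in the
  stabilization, but \<open>F(a) y\<close> does, as it dies in the injective object that contains the middle term.
  The hypothesis, applied to \<open>a\<close>, replaces \<open>y\<close> by an element of the stabilization.
\<close>

lemma stab_exact_of_epic:
  assumes stab_epic: "\<And>e. epic C e \<Longrightarrow> epic D (arr_map stab e)"
    and fg: "right_exact_seq C f g"
  shows "exact_at D (arr_map stab f) (arr_map stab g)"
  unfolding D.exact_at_iff
proof (intro conjI ballI impI)
  have "exact_at C f g" using fg by (simp add: C.right_exact_seq_iff)
  note arfg = C.exact_at_zeroD[OF this]
  let ?A = "Dom C f" and ?B = "Dom C g" and ?C = "Cod C g"
  have Ob: "?A \<in> Ob C" "?B \<in> Ob C" "?C \<in> Ob C" using arfg by simp_all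
  show "arr_map stab f \<in> Ar D" "arr_map stab g \<in> Ar D"
    "Cod D (arr_map stab f) = Dom D (arr_map stab g)"
    using arfg by simp_all
  have "\<kappa> ?C \<bullet>\<^bsub>D\<^esub> arr_map stab (Zero C ?A ?C) = Zero D (Dom D (\<kappa> ?A)) (Cod D (\<kappa> ?C))"
    using stab_square[of "Zero C ?A ?C"] Ob by (simp add: F_zero)
  then have "arr_map stab (Zero C ?A ?C) = Zero D (Dom D (\<kappa> ?A)) (Dom D (\<kappa> ?C))"
    by - (rule D.monic_zeroD[OF kappa_monic[OF Ob(3)]], use Ob in simp_all)
  then show "arr_map stab g \<bullet>\<^bsub>D\<^esub> arr_map stab f
      = Zero D (Dom D (arr_map stab f)) (Cod D (arr_map stab g))"
    using stab_comp[of f g] arfg by simp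
  fix x assume "x \<in> Ar D" "Cod D x = Dom D (arr_map stab g)"
    "arr_map stab g \<bullet>\<^bsub>D\<^esub> x = Zero D (Dom D x) (Cod D (arr_map stab g))"
  then have x: "x \<in> Ar D" "Cod D x = Dom D (\<kappa> ?B)"
      "arr_map stab g \<bullet>\<^bsub>D\<^esub> x = Zero D (Dom D x) (Dom D (\<kappa> ?C))"
    using arfg by simp_all
  let ?kx = "\<kappa> ?B \<bullet>\<^bsub>D\<^esub> x"
  have kx: "?kx \<in> Ar D" "Dom D ?kx = Dom D x" "Cod D ?kx = obj_map F ?B"
    using x Ob by simp_all
  have "arr_map F g \<bullet>\<^bsub>D\<^esub> ?kx = Zero D (Dom D ?kx) (obj_map F ?C)"
    using stab_square_comp[of g x] x arfg Ob by simp
  then obtain p y where py: "epic D p" "Cod D p = Dom D x" "y \<in> Ar D" "Dom D y = Dom D p"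
    "Cod D y = obj_map F ?A" "arr_map F f \<bullet>\<^bsub>D\<^esub> y = ?kx \<bullet>\<^bsub>D\<^esub> p"
    using D.exact_at_lift[OF F_exact[OF fg], of ?kx] kx arfg by auto
  have arp: "p \<in> Ar D" using D.epic_arrow py by blast
  obtain i a where ia: "monic C i" "epic C a" "Cod C a = Dom C i" "i \<bullet>\<^bsub>C\<^esub> a = f"
    using C.image_factorization arfg by blast
  have ar: "i \<in> Ar C" "a \<in> Ar C" using ia C.monic_arrow C.epic_arrow by blast+
  have ia': "Dom C a = ?A" "Cod C i = ?B"
    using ar ia(3) arfg(3) by (auto simp flip: ia(4))
  let ?A' = "Dom C i"
  have A': "?A' \<in> Ob C" using ar by simp
  let ?ay = "arr_map F a \<bullet>\<^bsub>D\<^esub> y"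
  have ay: "?ay \<in> Ar D" "Dom D ?ay = Dom D p" "Cod D ?ay = obj_map F ?A'"
    using py ar ia(3) ia' by simp_all
  have iay: "arr_map F i \<bullet>\<^bsub>D\<^esub> ?ay = ?kx \<bullet>\<^bsub>D\<^esub> p"
    unfolding py(6)[symmetric] ia(4)[symmetric] using ar ia(3) ia' py(3-5) by (simp add: F_comp)
  have mi: "monic C (\<iota> ?B \<bullet>\<^bsub>C\<^esub> i)"
    using C.monic_comp[OF ia(1) iota_monic[OF Ob(2)]] ia' Ob by simp
  have "arr_map F (\<iota> ?B \<bullet>\<^bsub>C\<^esub> i) \<bullet>\<^bsub>D\<^esub> ?ay = arr_map F (\<iota> ?B) \<bullet>\<^bsub>D\<^esub> (arr_map F i \<bullet>\<^bsub>D\<^esub> ?ay)"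
    using ay ar Ob ia' by (simp only: F_comp iota_arrow D.comp_assoc F_arrow)
  also have "\<dots> = (arr_map F (\<iota> ?B) \<bullet>\<^bsub>D\<^esub> \<kappa> ?B) \<bullet>\<^bsub>D\<^esub> (x \<bullet>\<^bsub>D\<^esub> p)"
    unfolding iay using x py(2) arp Ob by simp
  also have "\<dots> = Zero D (Dom D ?ay) (obj_map F (Cod C (\<iota> ?B)))"
    unfolding kappa_killed[OF Ob(2)] ay(2) using x py(2) arp Ob by simp
  finally have "arr_map F (\<iota> ?A') \<bullet>\<^bsub>D\<^esub> ?ay = Zero D (Dom D ?ay) (obj_map F (Cod C (\<iota> ?A')))"
    using killed_of_monic[OF mi _ ay(1), of ?A'] ay(3) ar ia' Ob by simp
  then obtain w where w: "w \<in> Ar D" "Dom D w = Dom D p" "Cod D w = Dom D (\<kappa> ?A')"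
    "\<kappa> ?A' \<bullet>\<^bsub>D\<^esub> w = ?ay"
    using kappa_factor[OF A' ay(1) ay(3)] ay(2) by auto
  obtain p' v where pv: "epic D p'" "Cod D p' = Dom D p" "v \<in> Ar D" "Dom D v = Dom D p'"
    "Cod D v = Dom D (\<kappa> ?A)" "arr_map stab a \<bullet>\<^bsub>D\<^esub> v = w \<bullet>\<^bsub>D\<^esub> p'"
    using D.pullback_of_epic[OF stab_epic[OF ia(2)], of w] w ar ia(3) ia' by auto
  have arp': "p' \<in> Ar D" using D.epic_arrow pv by blast
  have "\<kappa> ?B \<bullet>\<^bsub>D\<^esub> (arr_map stab f \<bullet>\<^bsub>D\<^esub> v) = \<kappa> ?B \<bullet>\<^bsub>D\<^esub> (arr_map stab i \<bullet>\<^bsub>D\<^esub> (w \<bullet>\<^bsub>D\<^esub> p'))"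
    using stab_comp[of a i] ia(3,4) ia' ar pv(3-6) by simp
  also have "\<dots> = arr_map F i \<bullet>\<^bsub>D\<^esub> (\<kappa> ?A' \<bullet>\<^bsub>D\<^esub> (w \<bullet>\<^bsub>D\<^esub> p'))"
    using stab_square_comp[of i "w \<bullet>\<^bsub>D\<^esub> p'"] w(1-3) pv(2) arp' ar ia' by simp
  also have "\<kappa> ?A' \<bullet>\<^bsub>D\<^esub> (w \<bullet>\<^bsub>D\<^esub> p') = ?ay \<bullet>\<^bsub>D\<^esub> p'"
    unfolding w(4)[symmetric] using w(1-3) pv(2) arp' A' by simp
  also have "arr_map F i \<bullet>\<^bsub>D\<^esub> (?ay \<bullet>\<^bsub>D\<^esub> p') = (arr_map F i \<bullet>\<^bsub>D\<^esub> ?ay) \<bullet>\<^bsub>D\<^esub> p'"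
    by (rule D.comp_assoc[symmetric]) (use ay pv(2) arp' ar in simp_all)
  also have "\<dots> = \<kappa> ?B \<bullet>\<^bsub>D\<^esub> (x \<bullet>\<^bsub>D\<^esub> (p \<bullet>\<^bsub>D\<^esub> p'))"
    unfolding iay using x py(2) pv(2) arp arp' Ob by simp
  finally have "arr_map stab f \<bullet>\<^bsub>D\<^esub> v = x \<bullet>\<^bsub>D\<^esub> (p \<bullet>\<^bsub>D\<^esub> p')"
    using D.monic_cancel[OF kappa_monic[OF Ob(2)], of "arr_map stab f \<bullet>\<^bsub>D\<^esub> v" "x \<bullet>\<^bsub>D\<^esub> (p \<bullet>\<^bsub>D\<^esub> p')"]
      x py(2) pv arp arp' arfg by simp
  then show "\<exists>p y. epic D p \<and> Cod D p = Dom D x \<and> y \<in> Ar D \<and> Dom D y = Dom D p \<and>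
      Cod D y = Dom D (arr_map stab f) \<and> arr_map stab f \<bullet>\<^bsub>D\<^esub> y = x \<bullet>\<^bsub>D\<^esub> p"
    using D.epic_comp[OF pv(1) py(1) pv(2)] py(2) pv arp arp' arfg
    by (intro exI[of _ "p \<bullet>\<^bsub>D\<^esub> p'"] exI[of _ v]) simp
qed

lemma stab_vanishes_on_injective:
  assumes "is_injective C J"
  shows "\<kappa> J = Zero D (Dom D (\<kappa> J)) (obj_map F J)"
proof -
  have J: "J \<in> Ob C" using assms by (simp add: is_injective_def)
  show ?thesis
    using killed_in_injective[of "Idt C J" J "\<kappa> J"] assms J kappa_killed[OF J]
    by (simp add: F_identity)
qed

text \<open>
  The stabilization vanishes at the injective \<open>J\<close> covering \<open>X\<close>, hence at \<open>X\<close>. Anything killed by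
  \<open>F(i)\<close> for a monic \<open>i\<close> out of \<open>X\<close> lies in the stabilization at \<open>X\<close>, so it is zero.
\<close>

lemma property_A_of_stab_epic:
  assumes stab_epic: "\<And>e. epic C e \<Longrightarrow> epic D (arr_map stab e)"
    and X: "cosyzygy_object C X"
  shows "property_A C D F X"
proof -
  obtain J e where J: "is_injective C J" and e: "e \<in> Ar C" "Dom C e = J" "Cod C e = X" "epic C e"
    using X by (auto simp: cosyzygy_object_def Hom_iff)
  have XOb: "X \<in> Ob C" and JOb: "J \<in> Ob C" using e by auto
  have "\<kappa> X \<bullet>\<^bsub>D\<^esub> arr_map stab e = arr_map F e \<bullet>\<^bsub>D\<^esub> \<kappa> J"
    using stab_square[OF e(1)] e by simp
  also have "\<dots> = Zero D (Dom D (\<kappa> J)) (obj_map F X)"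
    by (subst stab_vanishes_on_injective[OF J]) (use e JOb in simp)
  finally have ke: "\<kappa> X \<bullet>\<^bsub>D\<^esub> arr_map stab e = Zero D (Dom D (\<kappa> J)) (obj_map F X)" .
  have kX: "\<kappa> X = Zero D (Dom D (\<kappa> X)) (obj_map F X)"
    by (rule D.epic_zeroD[OF stab_epic[OF e(4)]]) (use ke e(1-3) XOb in simp_all)
  have "monic D (arr_map F i)" if i: "monic C i" "Dom C i = X" for i
  proof (rule D.monicI)
    have ar: "i \<in> Ar C" using i C.monic_arrow by blast
    then show "arr_map F i \<in> Ar D" by simp
    fix x assume x: "x \<in> Ar D" "Cod D x = Dom D (arr_map F i)"
      "arr_map F i \<bullet>\<^bsub>D\<^esub> x = Zero D (Dom D x) (Cod D (arr_map F i))"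
    have x': "Cod D x = obj_map F X" "arr_map F i \<bullet>\<^bsub>D\<^esub> x = Zero D (Dom D x) (obj_map F (Cod C i))"
      using x(2,3) ar i(2) by simp_all
    obtain w where w: "w \<in> Ar D" "Dom D w = Dom D x" "Cod D w = Dom D (\<kappa> X)" "\<kappa> X \<bullet>\<^bsub>D\<^esub> w = x"
      using kappa_factor[OF XOb x(1) x'(1) killed_of_monic[OF i x(1) x']] by blast
    have "x = Zero D (Dom D (\<kappa> X)) (obj_map F X) \<bullet>\<^bsub>D\<^esub> w" using w(4) kX by metis
    also have "\<dots> = Zero D (Dom D x) (obj_map F X)" using w(1-3) XOb by simp
    finally show "x = Zero D (Dom D x) (Dom D (arr_map F i))" using ar i(2) by simp
  qed
  then show ?thesis using XOb by (auto simp: property_A_def)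
qed

end

section \<open>Right exactness of the stabilization\<close>

theorem theorem7p10:
  fixes C :: "('o, 'm, 'c) acat_scheme"
    and D :: "('p, 'n, 'd) acat_scheme"
    and F :: "('o, 'm, 'p, 'n) fctr"
    and \<iota> \<delta> :: "'o \<Rightarrow> 'm"
  assumes "abelian_category C"
    and "abelian_category D"
    and "enough_injectives C"
    and "right_exact C D F"
    and "\<And>B. B \<in> Ob C \<Longrightarrow> injective_copresentation C B (\<iota> B) (\<delta> B)"
  shows "right_exact C D (injective_stabilization C D \<iota> \<delta> F) \<longleftrightarrow>
    (\<forall>X. cosyzygy_object C X \<longrightarrow> property_A C D F X)"
proof -
  interpret C: abelian_category C by fact
  interpret D: abelian_category D by fact
  interpret stabilized_functor C D F \<iota> \<delta>
    by unfold_locales (fact assms)+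
  show ?thesis
  proof
    assume R: "right_exact C D stab"
    interpret S: right_exact_functor C D stab
      by unfold_locales (fact R)
    show "\<forall>X. cosyzygy_object C X \<longrightarrow> property_A C D F X"
      using property_A_of_stab_epic[OF S.F_epic] by blast
  next
    assume "\<forall>X. cosyzygy_object C X \<longrightarrow> property_A C D F X"
    then have "epic D (arr_map stab e)" if "epic C e" for e
      using stab_epic_of_property_A[OF assms(3)] that by blast
    then show "right_exact C D stab"
      using stab_functor stab_exact_of_epic
      by (auto simp: right_exact_def C.right_exact_seq_iff D.right_exact_seq_iff)
  qed
qed

end
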